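(* Let $L>0$, let $a$ satisfy (H_a), $h\in L^2(0,L)$, and let $\phi$ satisfy (H_φ), (H_int) and (H_bdd). Then the Cauchy problem (C) has at least one solution, i.e. there exists $v\in H^1(0,L)$ with $\phi(v)\in L^2(0,L)$, $a\frac{dv}{dx}=\phi(v)+h$ in $\mathcal D'(0,L)$ and $v(0)=0$.
   Context: (H_a): $a\in L^\infty(0,L)$ and there are constants $0<\alpha<\beta$ with $\alpha\le a(x)\le\beta$ for a.e. $x\in(0,L)$. (H_φ): $\phi:\mathbb{R}\to\mathbb{R}\cup\{+\infty\}$ is continuous when $\mathbb{R}\cup\{+\infty\}$ carries its usual topology, and $\phi(s)<+\infty$ for every $s\neq0$. (H_int): $\int_0^\delta\phi(t)\,dt<+\infty$ and $\int_{-\delta}^0\phi(t)\,dt<+\infty$ for every $\delta\in(0,1)$. (H_bdd): for every $\delta>0$, $\phi$ is bounded (and continuous) on $\mathbb{R}\setminus(-\delta,\delta)$. Problem (C) with data $(a,h,\phi)$: find $v\in H^1(0,L)$ with $\phi(v)\in L^2(0,L)$, $a\frac{dv}{dx}=\phi(v)+h$ in $\mathcal D'(0,L)$, $v(0)=0$. *)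

theory Defs
  imports "HOL-Analysis.Analysis"
begin

definition L2_on :: "real \<Rightarrow> (real \<Rightarrow> real) \<Rightarrow> bool" where
  "L2_on L f \<longleftrightarrow> set_borel_measurable lborel {0<..<L} f
      \<and> set_integrable lborel {0<..<L} (\<lambda>x. (f x)^2)"

definition test_fun :: "real \<Rightarrow> (real \<Rightarrow> real) \<Rightarrow> bool" where
  "test_fun L \<psi> \<longleftrightarrow> (\<forall>k x. ((deriv ^^ k) \<psi>) differentiable (at x))
      \<and> (\<exists>c d. 0 < c \<and> c \<le> d \<and> d < L \<and> (\<forall>x. x \<notin> {c..d} \<longrightarrow> \<psi> x = 0))"

definition weak_deriv_on :: "real \<Rightarrow> (real \<Rightarrow> real) \<Rightarrow> (real \<Rightarrow> real) \<Rightarrow> bool" where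
  "weak_deriv_on L v w \<longleftrightarrow> (\<forall>\<psi>. test_fun L \<psi> \<longrightarrow>
      (LINT x:{0<..<L}|lborel. v x * deriv \<psi> x) = - (LINT x:{0<..<L}|lborel. w x * \<psi> x))"

definition H1_on :: "real \<Rightarrow> (real \<Rightarrow> real) \<Rightarrow> bool" where
  "H1_on L v \<longleftrightarrow> L2_on L v \<and> (\<exists>w. L2_on L w \<and> weak_deriv_on L v w)"

definition H_a :: "real \<Rightarrow> (real \<Rightarrow> real) \<Rightarrow> real \<Rightarrow> real \<Rightarrow> bool" where
  "H_a L a \<alpha> \<beta> \<longleftrightarrow> set_borel_measurable lborel {0<..<L} a \<and> 0 < \<alpha> \<and> \<alpha> < \<beta>
      \<and> (AE x in lborel. x \<in> {0<..<L} \<longrightarrow> \<alpha> \<le> a x \<and> a x \<le> \<beta>)"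

definition H_phi :: "(real \<Rightarrow> ereal) \<Rightarrow> bool" where
  "H_phi \<phi> \<longleftrightarrow> continuous_on UNIV \<phi> \<and> (\<forall>s. \<phi> s \<noteq> -\<infinity>) \<and> (\<forall>s. s \<noteq> 0 \<longrightarrow> \<phi> s \<noteq> \<infinity>)"

definition H_int :: "(real \<Rightarrow> ereal) \<Rightarrow> bool" where
  "H_int \<phi> \<longleftrightarrow> (\<forall>\<delta>. 0 < \<delta> \<and> \<delta> < 1 \<longrightarrow>
      set_integrable lborel {0<..<\<delta>} (\<lambda>t. real_of_ereal (\<phi> t))
    \<and> set_integrable lborel {-\<delta><..<0} (\<lambda>t. real_of_ereal (\<phi> t)))"

definition H_bdd :: "(real \<Rightarrow> ereal) \<Rightarrow> bool" where
  "H_bdd \<phi> \<longleftrightarrow> (\<forall>\<delta>>0. \<exists>M::real. \<forall>s. \<delta> \<le> \<bar>s\<bar> \<longrightarrow> \<bar>\<phi> s\<bar> \<le> ereal M)"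

end

(* Writing b = 1/a, the problem is the integral equation v(x) = integral_0^x (phi(v) + h) b.
   Truncate phi at height n and run an Euler scheme whose mesh is so fine that
   u_n = min(phi, n) o z_n, with z_n the frozen values, is uniformly close to min(phi, n)(v_n).
   With F_n a primitive of min(phi, n), the mean value theorem on each mesh cell gives the energy inequality
   F_n(v_n(L)) - F_n(0) >= integral (u_n (u_n + h) - |u_n + h|) b.
   By (H_int) and (H_bdd), F_n grows at most linearly, uniformly in n, so u_n is bounded in L^2.
   Hence the v_n are equicontinuous and, along a subsequence, v_n -> v uniformly and u_n -> phi(v)
   pointwise in the extended reals.  Fatou's lemma applied to u_n^2 shows that phi(v) is in L^2; in particular
   {v = 0} is a null set if phi(0) is infinite.  The L^2 bound upgrades the pointwise convergence to L^1. *)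
theory Submission
  imports Defs "HOL-Complex_Analysis.Great_Picard"
begin

subsection \<open>The Euler scheme\<close>

text \<open>The initial value sits exactly where \<open>\<phi>\<close> may be infinite, so existence
  theorems for a continuous right-hand side do not apply, and the sup norms of the truncations may
  blow up with n. The uniform bound therefore comes from energy: for an exact solution of v' = (u +
  h) b with u = g(v), multiplication by u gives (F o v)' = u (u + h) b. This is quadratic in u,
  whereas F(v(L)) - F(0) is at most linear in |v(L)|, hence in the integral of |u + h| b. Since the
  discrete solutions already satisfy the inequality, mesh and truncation go to the limit together
  and the truncated problems are never solved exactly. Convergence is taken in the extended reals
  because \<open>real_of_ereal\<close> sends infinity to 0: without a separate proof of finiteness,
  square integrability of the real-valued composition would not exclude that \<open>\<phi>\<close>
  is infinite along v on a set of positive measure.\<close>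

lemma integrable_on_dominated:
  fixes f G :: "real \<Rightarrow> real"
  assumes "f \<in> borel_measurable borel" "set_integrable lborel {p..q} G"
    and "\<And>t. t \<in> {p..q} \<Longrightarrow> \<bar>f t\<bar> \<le> G t"
  shows "set_integrable lborel {p..q} f" "f integrable_on {p..q}"
proof -
  show 1: "set_integrable lborel {p..q} f"
    by (rule set_integrable_bound[OF assms(2)])
      (use assms in \<open>auto simp: set_borel_measurable_def intro!: AE_I2\<close>, fastforce)
  show "f integrable_on {p..q}"
    using set_borel_integral_eq_integral[OF 1] by simp
qed

lemma set_integrable_abs_of_square:
  fixes h :: "real \<Rightarrow> real"
  assumes "h \<in> borel_measurable borel" "set_integrable lborel {p..q} (\<lambda>t. (h t)\<^sup>2)"
  shows "set_integrable lborel {p..q} (\<lambda>t. \<bar>h t\<bar>)"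
proof (rule integrable_on_dominated(1))
  show "set_integrable lborel {p..q} (\<lambda>t. 1 + (h t)\<^sup>2)"
    by (intro set_integral_add(1) assms borel_integrable_atLeastAtMost' continuous_intros)
  show "\<bar>\<bar>h t\<bar>\<bar> \<le> 1 + (h t)\<^sup>2" for t
    using zero_le_power2[of "\<bar>h t\<bar> - 1"] by (simp add: power2_diff)
qed (use assms in measurable)

text \<open>The solution may rise or fall over a mesh cell, so the mean value theorem is wanted
  without an order on the endpoints.\<close>

lemma mean_value_two_sided:
  fixes F :: "real \<Rightarrow> real"
  assumes "\<And>s. (F has_real_derivative g s) (at s)"
  obtains \<xi> where "\<xi> \<in> closed_segment p q" "F q - F p = (q - p) * g \<xi>"
proof (cases p q rule: linorder_cases)
  case less
  then obtain z where "p < z" "z < q" "F q - F p = (q - p) * g z"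
    using MVT2[of p q F g] assms by auto
  then show ?thesis using that[of z] by (auto simp: closed_segment_eq_real_ivl)
next
  case greater
  then obtain z where "q < z" "z < p" "F p - F q = (p - q) * g z"
    using MVT2[of q p F g] assms by auto
  then show ?thesis using that[of z] by (auto simp: closed_segment_eq_real_ivl algebra_simps)
qed (use that in auto)

text \<open>On a cell with frozen value \<open>p\<close> and end value \<open>q\<close>, the
  increment of \<open>F\<close> is \<open>g \<xi>\<close> times the integral of
  \<open>(g p + h) * b\<close>. Replacing \<open>g \<xi>\<close> by \<open>g p\<close> costs at most
  \<open>\<bar>g p + h\<bar> * b\<close> once the cell is short enough, and summing over the cells
  gives the last conclusion.\<close>

lemma euler_scheme:
  fixes g F h b :: "real \<Rightarrow> real"
  assumes "L > 0" and hm[measurable]: "h \<in> borel_measurable borel"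
    and bm[measurable]: "b \<in> borel_measurable borel"
    and h2: "set_integrable lborel {0..L} (\<lambda>t. (h t)\<^sup>2)"
    and b: "\<And>t. 0 \<le> b t" "\<And>t. b t \<le> C"
    and g: "continuous_on UNIV g" "\<And>s. \<bar>g s\<bar> \<le> B"
    and F: "\<And>s. (F has_real_derivative g s) (at s)" and "\<epsilon> > 0"
  obtains z where "z \<in> borel_measurable borel"
    "\<And>t. t \<in> {0..<L} \<Longrightarrow> \<bar>z t - integral {0..t} (\<lambda>s. (g (z s) + h s) * b s)\<bar> \<le> \<epsilon>"
    "integral {0..L} (\<lambda>t. (g (z t) * (g (z t) + h t) - \<bar>g (z t) + h t\<bar>) * b t)
      \<le> F (integral {0..L} (\<lambda>s. (g (z s) + h s) * b s)) - F 0"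
proof -
  have gm[measurable]: "g \<in> borel_measurable borel"
    using g(1) by (rule borel_measurable_continuous_onI)
  have B0: "B \<ge> 0" using g(2)[of 0] by linarith
  have C0: "C \<ge> 0" using b[of 0] by linarith
  note habs = set_integrable_abs_of_square[OF hm h2]
  \<comment> \<open>Majorants of \<open>w z\<close> and \<open>e z\<close> that do not depend on
    \<open>z\<close>: the mesh must be fixed before the scheme produces \<open>z\<close>. The
    primitive \<open>W\<close> of \<open>D\<close> then controls the increments of every
    \<open>v z\<close> at once.\<close>
  define D where "D s = (B + \<bar>h s\<bar>) * C" for s
  define E where "E s = (B * (B + \<bar>h s\<bar>) + (B + \<bar>h s\<bar>)) * C" for s
  define W where "W x = integral {0..x} D" for x
  define w where "w z s = (g (z s) + h s) * b s" for z :: "real \<Rightarrow> real" and s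
  define v where "v z x = integral {0..x} (w z)" for z x
  define e where "e z t = (g (z t) * (g (z t) + h t) - \<bar>g (z t) + h t\<bar>) * b t"
    for z :: "real \<Rightarrow> real" and t
  have constint: "set_integrable lborel {0..L} (\<lambda>s. k)" for k :: real
    by (intro borel_integrable_atLeastAtMost' continuous_intros)
  have Dint: "set_integrable lborel {0..L} D"
    unfolding D_def by (intro set_integrable_mult_left set_integral_add(1) constint habs)
  have Eint: "set_integrable lborel {0..L} E"
    unfolding E_def
    by (intro set_integrable_mult_left set_integrable_mult_right set_integral_add(1) constint habs)
  have wD: "\<bar>w z s\<bar> \<le> D s" for z s
    unfolding w_def D_def abs_mult using b[of s] g(2)[of "z s"] C0 by (intro mult_mono) auto
  have eE: "\<bar>e z s\<bar> \<le> E s" for z s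
  proof -
    have 1: "\<bar>g (z s) + h s\<bar> \<le> B + \<bar>h s\<bar>" using g(2)[of "z s"] by linarith
    have "\<bar>g (z s) * (g (z s) + h s)\<bar> \<le> B * (B + \<bar>h s\<bar>)"
      unfolding abs_mult using 1 g(2)[of "z s"] B0 by (intro mult_mono) auto
    then have "\<bar>g (z s) * (g (z s) + h s) - \<bar>g (z s) + h s\<bar>\<bar> \<le> B * (B + \<bar>h s\<bar>) + (B + \<bar>h s\<bar>)"
      using 1 by linarith
    then show ?thesis unfolding e_def E_def abs_mult using b[of s] C0
      by (intro mult_mono) auto
  qed
  have sub: "f integrable_on {x..y}" if "f integrable_on {0..L}" "0 \<le> x" "y \<le> L"
    for f :: "real \<Rightarrow> real" and x y
    by (rule integrable_on_subinterval[OF that(1)]) (use that in auto)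
  have Dio: "D integrable_on {0..L}" using set_borel_integral_eq_integral(1)[OF Dint] .
  have wio: "w z integrable_on {0..L}" if [measurable]: "z \<in> borel_measurable borel" for z
    by (rule integrable_on_dominated(2)[OF _ Dint wD]) (unfold w_def, measurable)
  have eio: "e z integrable_on {0..L}" if [measurable]: "z \<in> borel_measurable borel" for z
    by (rule integrable_on_dominated(2)[OF _ Eint eE]) (unfold e_def, measurable)
  have Wdiff: "integral {x..y} D = W y - W x" if "0 \<le> x" "x \<le> y" "y \<le> L" for x y
    using Henstock_Kurzweil_Integration.integral_combine[of 0 x y D] that sub[OF Dio, of 0 y] by (simp add: W_def)
  have vdiff: "integral {x..y} (w z) = v z y - v z x"
    if "0 \<le> x" "x \<le> y" "y \<le> L" "z \<in> borel_measurable borel" for x y z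
    using Henstock_Kurzweil_Integration.integral_combine[of 0 x y "w z"] that sub[OF wio, of z 0 y] by (simp add: v_def)
  have vW: "\<bar>v z y - v z x\<bar> \<le> W y - W x"
    if "0 \<le> x" "x \<le> y" "y \<le> L" "z \<in> borel_measurable borel" for x y z
  proof -
    have "norm (integral {x..y} (w z)) \<le> integral {x..y} D"
      by (rule integral_norm_bound_integral) (use sub[OF wio] sub[OF Dio] that wD in auto)
    then show ?thesis using Wdiff[OF that(1-3)] vdiff[OF that] by simp
  qed
  have W0: "W 0 = 0" and v0: "v z 0 = 0" for z by (simp_all add: W_def v_def)
  have D0: "D s \<ge> 0" for s unfolding D_def using B0 C0 by simp
  have Wmono: "W x \<le> W y" if "0 \<le> x" "x \<le> y" "y \<le> L" for x y
  proof -
    have "0 \<le> integral {x..y} D" by (rule integral_nonneg) (use sub[OF Dio] that D0 in auto)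
    then show ?thesis using Wdiff[OF that] by simp
  qed
  have vR: "v z x \<in> {- W L..W L}" if "x \<in> {0..L}" "z \<in> borel_measurable borel" for x z
    using vW[of 0 x z] Wmono[of x L] that W0 v0[of z] by auto
  \<comment> \<open>By \<open>vR\<close> every \<open>v z\<close> takes its values in this compact
    interval, so one modulus of continuity of \<open>g\<close> serves all cells.\<close>
  have "uniformly_continuous_on {- W L..W L} g"
    by (intro compact_uniformly_continuous continuous_on_subset[OF g(1)]) auto
  then obtain \<delta> where \<delta>: "\<delta> > 0"
    "\<And>s s'. s \<in> {- W L..W L} \<Longrightarrow> s' \<in> {- W L..W L} \<Longrightarrow> dist s' s < \<delta> \<Longrightarrow> dist (g s') (g s) < 1"
    unfolding uniformly_continuous_on_def by (metis zero_less_one)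
  \<comment> \<open>An increment below \<open>\<delta>\<close> keeps the oscillation of
    \<open>g\<close> on a cell below 1, as the energy needs; one below \<open>\<epsilon>\<close>
    keeps \<open>z\<close> close to \<open>v z\<close>. Since \<open>h\<close> may be unbounded, the
    mesh is chosen from the uniform continuity of \<open>W\<close> instead of a Lipschitz
    bound.\<close>
  define \<eta> where "\<eta> = min \<delta> \<epsilon>"
  have "\<eta> > 0" using \<delta>(1) \<open>\<epsilon> > 0\<close> by (simp add: \<eta>_def)
  have "uniformly_continuous_on {0..L} W"
    unfolding W_def by (intro compact_uniformly_continuous indefinite_integral_continuous_1 Dio) auto
  then obtain d where d: "d > 0"
    "\<And>x y. x \<in> {0..L} \<Longrightarrow> y \<in> {0..L} \<Longrightarrow> dist y x < d \<Longrightarrow> dist (W y) (W x) < \<eta>"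
    unfolding uniformly_continuous_on_def using \<open>\<eta> > 0\<close> by metis
  obtain N :: nat where N: "N > 0" "L / N < d"
  proof -
    obtain N :: nat where "N > L / d" using reals_Archimedean2 by blast
    moreover from this have "N > 0" using \<open>L > 0\<close> d(1) by (metis divide_pos_pos of_nat_0_less_iff order_less_trans)
    ultimately show thesis using that[of N] d(1) by (simp add: field_simps)
  qed
  \<comment> \<open>The interval is half-open because the value frozen at \<open>X\<close> is set
    only when the next cell is processed.\<close>
  define Q where "Q z X \<longleftrightarrow> z \<in> borel_measurable borel \<and> (\<forall>t\<in>{0..<X}. \<bar>z t - v z t\<bar> \<le> \<epsilon>)
    \<and> integral {0..X} (e z) \<le> F (v z X) - F 0" for z X
  have step: "\<exists>z'. Q z' Y" if Q: "Q z X" and X: "0 \<le> X" "X \<le> Y" "Y \<le> L" and WXY: "W Y - W X < \<eta>" for z X Y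
  proof -
    define p where "p = v z X"
    define z' where "z' t = (if t < X then z t else p)" for t
    have [measurable]: "z \<in> borel_measurable borel" using Q by (simp add: Q_def)
    have zm[measurable]: "z' \<in> borel_measurable borel" unfolding z'_def by measurable
    \<comment> \<open>\<open>z'\<close> agrees with \<open>z\<close> strictly to the left of
      \<open>X\<close> but possibly not at \<open>X\<close> itself, which is a null set.\<close>
    have eq: "integral {0..x} (k z') = integral {0..x} (k z)"
      if "x \<le> X" "\<And>t. z t = z' t \<Longrightarrow> k z t = k z' t"
      for x and k :: "(real \<Rightarrow> real) \<Rightarrow> real \<Rightarrow> real"
      proof (rule integral_spike[of "{X}"])
      show "k z t = k z' t" if "t \<in> {0..x} - {X}" for t
        using that \<open>x \<le> X\<close> by (intro \<open>\<And>t. z t = z' t \<Longrightarrow> k z t = k z' t\<close>) (simp add: z'_def)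
    qed simp
    have veq: "v z' x = v z x" if "x \<le> X" for x
      unfolding v_def by (rule eq[OF that]) (simp add: w_def)
    have eeq: "integral {0..X} (e z') = integral {0..X} (e z)"
      by (rule eq) (simp_all add: e_def)
    define q where "q = v z' Y"
    have pq: "\<bar>q - p\<bar> < \<eta>"
      using vW[OF X zm] WXY veq[of X] by (simp add: p_def q_def)
    obtain \<xi> where \<xi>: "\<xi> \<in> closed_segment p q" "F q - F p = (q - p) * g \<xi>"
      using mean_value_two_sided[OF F] by blast
    have pR: "p \<in> {- W L..W L}" "q \<in> {- W L..W L}"
      using vR[of X z] vR[of Y z'] X by (auto simp: p_def q_def)
    have "\<xi> \<in> {- W L..W L}" "\<bar>\<xi> - p\<bar> < \<delta>"
      using \<xi>(1) pR pq by (auto simp: closed_segment_eq_real_ivl \<eta>_def split: if_splits)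
    then have g\<xi>: "\<bar>g \<xi> - g p\<bar> < 1" using \<delta>(2)[OF pR(1)] by (simp add: dist_real_def)
    have int: "e z' integrable_on {X..Y}" "w z' integrable_on {X..Y}"
      using sub[OF eio[OF zm]] sub[OF wio[OF zm]] X by auto
    \<comment> \<open>Here \<open>z'\<close> is the constant \<open>p\<close>, so the left integrand
      minus the right one is \<open>((g p - g \<xi>) * (g p + h t) - \<bar>g p + h t\<bar>) * b
      t\<close>. This is nonpositive by \<open>g\<xi>\<close> and
      \<open>0 \<le> b t\<close>.\<close>
    have "integral {X..Y} (e z') \<le> integral {X..Y} (\<lambda>t. g \<xi> * w z' t)"
    proof (rule integral_le)
      show "(\<lambda>t. g \<xi> * w z' t) integrable_on {X..Y}"
        by (rule integrable_on_mult_right[OF int(2)])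
      show "e z' t \<le> g \<xi> * w z' t" if "t \<in> {X..Y}" for t
      proof -
        have "z' t = p" using that by (simp add: z'_def)
        moreover have "(g p - g \<xi>) * (g p + h t) \<le> \<bar>g p + h t\<bar>"
        proof -
          have "(g p - g \<xi>) * (g p + h t) \<le> \<bar>g p - g \<xi>\<bar> * \<bar>g p + h t\<bar>"
            by (metis abs_ge_self abs_mult)
          also have "\<dots> \<le> 1 * \<bar>g p + h t\<bar>" using g\<xi> by (intro mult_right_mono) auto
          finally show ?thesis by simp
        qed
        then have "(g p * (g p + h t) - \<bar>g p + h t\<bar>) * b t \<le> (g \<xi> * (g p + h t)) * b t"
          using b(1)[of t] by (intro mult_right_mono) (auto simp: algebra_simps)
        ultimately show ?thesis by (simp add: e_def w_def mult.assoc)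
      qed
    qed (use int in auto)
    also have "\<dots> = g \<xi> * (q - p)"
      using vdiff[OF X zm] veq[of X] by (simp add: p_def q_def)
    also have "\<dots> = F q - F p" using \<xi>(2) by simp
    finally have 1: "integral {X..Y} (e z') \<le> F q - F p" .
    have "integral {0..Y} (e z') = integral {0..X} (e z') + integral {X..Y} (e z')"
      using Henstock_Kurzweil_Integration.integral_combine[of 0 X Y "e z'"] X sub[OF eio[OF zm], of 0 Y] by simp
    also have "\<dots> \<le> F q - F 0"
      using 1 Q unfolding eeq by (simp add: Q_def p_def)
    finally have en: "integral {0..Y} (e z') \<le> F (v z' Y) - F 0" by (simp add: q_def)
    have "\<bar>z' t - v z' t\<bar> \<le> \<epsilon>" if "t \<in> {0..<Y}" for t
    proof (cases "t < X")
      case True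
      then show ?thesis using Q that veq[of t] by (auto simp: Q_def z'_def)
    next
      case False
      then have "\<bar>v z' t - v z' X\<bar> \<le> W t - W X" using vW[of X t z'] X that zm by auto
      also have "\<dots> \<le> W Y - W X" using Wmono[of t Y] that X by auto
      also have "\<dots> \<le> \<epsilon>" using WXY by (simp add: \<eta>_def)
      finally show ?thesis using False veq[of X] by (simp add: z'_def p_def)
    qed
    then have "Q z' Y" unfolding Q_def using zm en by blast
    then show ?thesis by blast
  qed
  have "\<exists>z. Q z (k * L / N)" if "k \<le> N" for k
    using that
  proof (induction k)
    case 0
    \<comment> \<open>With no cell processed the closeness condition is empty and the integrals run
      over a point, so any measurable start will do.\<close>
    show ?case by (rule exI[of _ "\<lambda>_. 0"]) (simp add: Q_def v0)
  next
    case (Suc k)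
    then obtain z where z: "Q z (k * L / N)" by auto
    have le: "Suc k * L / N \<le> L" "k * L / N \<le> L"
      using Suc.prems \<open>L > 0\<close> N(1) by (auto simp: pos_divide_le_eq simp del: of_nat_Suc)
    have diff: "Suc k * L / N - k * L / N = L / N" by (simp add: add_divide_distrib algebra_simps)
    show ?case
    proof (rule step[OF z])
      show "0 \<le> k * L / N" "Suc k * L / N \<le> L" using le \<open>L > 0\<close> by auto
      show "k * L / N \<le> Suc k * L / N" using diff \<open>L > 0\<close> N(1) by (simp add: divide_right_mono)
      then have "dist (W (Suc k * L / N)) (W (k * L / N)) < \<eta>"
        using diff N(2) le \<open>L > 0\<close>
        by (intro d(2)) (auto simp: dist_real_def simp del: of_nat_Suc)
      then show "W (Suc k * L / N) - W (k * L / N) < \<eta>" by (simp add: dist_real_def del: of_nat_Suc)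
    qed
  qed
  from this[of N] obtain z where "Q z L" using N(1) by auto
  then show thesis using that[of z] unfolding Q_def v_def w_def e_def by auto
qed

text \<open>The growth of \<open>F\<close> contributes \<open>C1\<close> times the integral of
  \<open>\<bar>u t + h t\<bar> * b t\<close> and the scheme contributes it once more; half of the
  square term absorbs both. The final division by \<open>c / 2\<close> turns \<open>C0\<close> into
  \<open>2 * C0\<close> and the factor 2 in \<open>base\<close> into 4. Neither \<open>B\<close> nor
  \<open>\<epsilon>\<close> enters the bound, so it can be uniform in the truncation level.\<close>

lemma euler_scheme_energy:
  fixes g F h b :: "real \<Rightarrow> real"
  assumes "L > 0" and hm[measurable]: "h \<in> borel_measurable borel"
    and bm[measurable]: "b \<in> borel_measurable borel"
    and h2: "set_integrable lborel {0..L} (\<lambda>t. (h t)\<^sup>2)"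
    and c: "0 < c" and b: "\<And>t. c \<le> b t" "\<And>t. b t \<le> C"
    and g: "continuous_on UNIV g" "\<And>s. \<bar>g s\<bar> \<le> B"
    and F: "\<And>s. (F has_real_derivative g s) (at s)"
    and F0: "\<And>y. F y - F 0 \<le> C0 + C1 * \<bar>y\<bar>" "C1 \<ge> 0" and "\<epsilon> > 0"
  obtains z where "z \<in> borel_measurable borel"
    "\<And>t. t \<in> {0..<L} \<Longrightarrow> \<bar>z t - integral {0..t} (\<lambda>s. (g (z s) + h s) * b s)\<bar> \<le> \<epsilon>"
    "integral {0..L} (\<lambda>t. (g (z t))\<^sup>2)
      \<le> (2 * C0 + integral {0..L} (\<lambda>t. 4 * ((h t)\<^sup>2 + (C1 + 1)\<^sup>2) * C)) / c"
proof -
  have b0: "0 \<le> b t" for t using b(1)[of t] c by simp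
  obtain z where z[measurable]: "z \<in> borel_measurable borel"
    and z1: "\<And>t. t \<in> {0..<L} \<Longrightarrow> \<bar>z t - integral {0..t} (\<lambda>s. (g (z s) + h s) * b s)\<bar> \<le> \<epsilon>"
    and z2: "integral {0..L} (\<lambda>t. (g (z t) * (g (z t) + h t) - \<bar>g (z t) + h t\<bar>) * b t)
      \<le> F (integral {0..L} (\<lambda>s. (g (z s) + h s) * b s)) - F 0"
    using euler_scheme[OF assms(1-4) b0 b(2) g F \<open>\<epsilon> > 0\<close>] by blast
  have gm[measurable]: "g \<in> borel_measurable borel"
    using g(1) by (rule borel_measurable_continuous_onI)
  define u where "u t = g (z t)" for t
  define K where "K = C1 + 1"
  have [measurable]: "u \<in> borel_measurable borel" unfolding u_def by measurable
  have uB: "\<bar>u t\<bar> \<le> B" for t using g(2) by (simp add: u_def)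
  have C: "C \<ge> 0" using b0[of 0] b(2)[of 0] by simp
  note constint = borel_integrable_atLeastAtMost'[OF continuous_on_const]
  have u2: "(u t)\<^sup>2 \<le> B\<^sup>2" for t using uB[of t] by (metis abs_le_square_iff abs_ge_self order_trans)
  \<comment> \<open>The three squares in fact 1 add up to \<open>u^2/2 + u*h + 5/4*h^2 -
    K*(\<bar>u\<bar> + \<bar>h\<bar>) + 2*K^2\<close>; fact 4 supplies the remaining
    \<open>3/4*h^2\<close>.\<close>
  have base: "(u t)\<^sup>2 / 2 - 2 * ((h t)\<^sup>2 + K\<^sup>2) \<le> (u t * (u t + h t) - \<bar>u t + h t\<bar>) - C1 * \<bar>u t + h t\<bar>" for t
  proof -
    have 0: "K * \<bar>u t + h t\<bar> \<le> K * (\<bar>u t\<bar> + \<bar>h t\<bar>)"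
      using \<open>C1 \<ge> 0\<close> by (intro mult_left_mono) (auto simp: K_def)
    have 1: "(u t / 2 + h t)\<^sup>2 \<ge> 0" "(\<bar>u t\<bar> / 2 - K)\<^sup>2 \<ge> 0" "(\<bar>h t\<bar> / 2 - K)\<^sup>2 \<ge> 0" by auto
    have 2: "\<bar>u t\<bar>\<^sup>2 = (u t)\<^sup>2" "\<bar>h t\<bar>\<^sup>2 = (h t)\<^sup>2" by auto
    have 3: "(u t * (u t + h t) - \<bar>u t + h t\<bar>) - C1 * \<bar>u t + h t\<bar> = (u t)\<^sup>2 + u t * h t - K * \<bar>u t + h t\<bar>"
      by (simp add: K_def algebra_simps power2_eq_square)
    have 4: "(h t)\<^sup>2 \<ge> 0" by simp
    show ?thesis
      unfolding 3 right_diff_distrib using 0 1 4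
      unfolding power2_sum power2_diff power_divide 2 distrib_left by (simp add: mult.commute, insert 4, linarith)
  qed
  note habs = set_integrable_abs_of_square[OF hm h2]
  define e where "e t = (u t * (u t + h t) - \<bar>u t + h t\<bar>) * b t" for t
  have "B \<ge> 0" using uB[of 0] by linarith
  have uh: "\<bar>u t + h t\<bar> \<le> B + \<bar>h t\<bar>" for t using uB[of t] by linarith
  have D: "set_integrable lborel {0..L} (\<lambda>t. (B + \<bar>h t\<bar>) * C)"
    by (intro set_integrable_mult_left set_integral_add(1) constint habs)
  have wio: "(\<lambda>t. (u t + h t) * b t) integrable_on {0..L}"
    by (rule integrable_on_dominated(2)[OF _ D], measurable)
      (use uh b0 b(2) \<open>B \<ge> 0\<close> in \<open>auto simp: abs_mult intro!: mult_mono\<close>)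
  have awio: "(\<lambda>t. \<bar>u t + h t\<bar> * b t) integrable_on {0..L}"
    by (rule integrable_on_dominated(2)[OF _ D], measurable)
      (use uh b0 b(2) \<open>B \<ge> 0\<close> in \<open>auto simp: abs_mult intro!: mult_mono\<close>)
  have eio: "e integrable_on {0..L}"
  proof (rule integrable_on_dominated(2))
    show "set_integrable lborel {0..L} (\<lambda>t. ((B + 1) * (B + \<bar>h t\<bar>)) * C)"
      by (intro set_integrable_mult_left set_integrable_mult_right set_integral_add(1) constint habs)
    show "\<bar>e t\<bar> \<le> ((B + 1) * (B + \<bar>h t\<bar>)) * C" for t
    proof -
      have "\<bar>u t * (u t + h t)\<bar> \<le> B * (B + \<bar>h t\<bar>)"
        unfolding abs_mult using uB[of t] uh[of t] \<open>B \<ge> 0\<close> by (intro mult_mono) auto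
      then have "\<bar>u t * (u t + h t) - \<bar>u t + h t\<bar>\<bar> \<le> (B + 1) * (B + \<bar>h t\<bar>)"
        using uh[of t] by (simp add: algebra_simps)
      then show ?thesis unfolding e_def abs_mult
        using b0[of t] b(2)[of t] by (intro mult_mono) auto
    qed
  qed (unfold e_def, measurable)
  have hio: "(\<lambda>t. 4 * ((h t)\<^sup>2 + K\<^sup>2) * C) integrable_on {0..L}"
    by (intro set_borel_integral_eq_integral(1) set_integrable_mult_left set_integrable_mult_right
        set_integral_add(1) constint h2)
  have u2io: "(\<lambda>t. (u t)\<^sup>2) integrable_on {0..L}"
    by (rule integrable_on_dominated(2)[OF _ constint[of _ _ "B\<^sup>2"]], measurable)
      (use u2 in auto)
  have "c / 2 * integral {0..L} (\<lambda>t. (u t)\<^sup>2) = integral {0..L} (\<lambda>t. c / 2 * (u t)\<^sup>2)"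
    by simp
  also have "\<dots> \<le> integral {0..L} (\<lambda>t. (e t - C1 * (\<bar>u t + h t\<bar> * b t)) + 1 / 2 * (4 * ((h t)\<^sup>2 + K\<^sup>2) * C))"
  proof (rule integral_le)
    \<comment> \<open>The weight \<open>b\<close> is estimated from below by \<open>c\<close> where
      it multiplies the square and from above by \<open>C\<close> where it multiplies the data; in
      the energy terms it is kept exact.\<close>
    show "c / 2 * (u t)\<^sup>2 \<le> (e t - C1 * (\<bar>u t + h t\<bar> * b t)) + 1 / 2 * (4 * ((h t)\<^sup>2 + K\<^sup>2) * C)" for t
    proof -
      have "c * ((u t)\<^sup>2 / 2) \<le> b t * ((u t)\<^sup>2 / 2)" using b(1)[of t] by (intro mult_right_mono) auto
      also have "\<dots> \<le> b t * (((u t * (u t + h t) - \<bar>u t + h t\<bar>) - C1 * \<bar>u t + h t\<bar>) + 2 * ((h t)\<^sup>2 + K\<^sup>2))"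
        using base[of t] b0[of t] by (intro mult_left_mono) linarith+
      also have "\<dots> = (e t - C1 * (\<bar>u t + h t\<bar> * b t)) + b t * (2 * ((h t)\<^sup>2 + K\<^sup>2))"
        by (simp add: e_def algebra_simps)
      also have "b t * (2 * ((h t)\<^sup>2 + K\<^sup>2)) \<le> C * (2 * ((h t)\<^sup>2 + K\<^sup>2))"
        using b(2)[of t] by (intro mult_right_mono) auto
      finally show ?thesis by (simp add: algebra_simps)
    qed
  qed (intro integrable_add integrable_diff integrable_on_mult_right u2io eio awio hio)+
  also have "\<dots> = integral {0..L} e - C1 * integral {0..L} (\<lambda>t. \<bar>u t + h t\<bar> * b t)
      + 1 / 2 * integral {0..L} (\<lambda>t. 4 * ((h t)\<^sup>2 + K\<^sup>2) * C)"
    by (simp only: integral_add integral_diff integral_mult_right integrable_add integrable_diff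
        integrable_on_mult_right eio awio hio)
  \<comment> \<open>The argument of \<open>F\<close> at the right end is itself the integral of
    \<open>(u t + h t) * b t\<close>, so the linear growth of \<open>F\<close> is cancelled exactly
    by the \<open>C1\<close> integral carried along since \<open>base\<close>.\<close>
  also have "\<dots> \<le> C0 + 1 / 2 * integral {0..L} (\<lambda>t. 4 * ((h t)\<^sup>2 + K\<^sup>2) * C)"
  proof -
    have "norm (integral {0..L} (\<lambda>t. (u t + h t) * b t)) \<le> integral {0..L} (\<lambda>t. \<bar>u t + h t\<bar> * b t)"
      by (rule integral_norm_bound_integral[OF wio awio]) (use b0 in \<open>simp add: abs_mult\<close>)
    then have "C1 * \<bar>integral {0..L} (\<lambda>t. (u t + h t) * b t)\<bar> \<le> C1 * integral {0..L} (\<lambda>t. \<bar>u t + h t\<bar> * b t)"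
      using \<open>C1 \<ge> 0\<close> by (intro mult_left_mono) auto
    then show ?thesis
      using z2 F0(1)[of "integral {0..L} (\<lambda>t. (u t + h t) * b t)"] by (simp add: u_def e_def[abs_def])
  qed
  finally have "integral {0..L} (\<lambda>t. (u t)\<^sup>2)
      \<le> (2 * C0 + integral {0..L} (\<lambda>t. 4 * ((h t)\<^sup>2 + K\<^sup>2) * C)) / c"
    using c by (simp add: field_simps)
  then show thesis using that[OF z z1] by (simp add: u_def K_def)
qed

subsection \<open>Pointwise limits of sequences bounded in L2\<close>

text \<open>A bound in L2 gives uniform integrability:
  \<open>\<bar>w\<bar> \<le> min \<bar>w\<bar> R + w^2 / R\<close>. The first part tends to 0 by
  dominated convergence, as constants are integrable for a finite measure; the second has integral
  at most \<open>K / R\<close> for every \<open>n\<close>.\<close>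

lemma AE_L2_bounded_imp_L1:
  fixes w :: "nat \<Rightarrow> 'a \<Rightarrow> real"
  assumes "finite_measure M" and [measurable]: "\<And>n. w n \<in> borel_measurable M"
    and int: "\<And>n. integrable M (\<lambda>x. (w n x)\<^sup>2)" and K: "\<And>n. (\<integral>x. (w n x)\<^sup>2 \<partial>M) \<le> K"
    and lim: "AE x in M. (\<lambda>n. w n x) \<longlonglongrightarrow> 0"
  shows "(\<lambda>n. \<integral>x. \<bar>w n x\<bar> \<partial>M) \<longlonglongrightarrow> 0"
proof (rule LIMSEQ_I)
  interpret finite_measure M by fact
  fix e :: real assume "e > 0"
  have "0 \<le> (\<integral>x. (w 0 x)\<^sup>2 \<partial>M)" by simp
  then have "K \<ge> 0" using K[of 0] by linarith
  \<comment> \<open>This makes \<open>K / R\<close> at most \<open>e / 2\<close>; the added 1 keeps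
    \<open>R\<close> positive when \<open>K = 0\<close>.\<close>
  define R where "R = 2 * (K + 1) / e"
  have "R > 0" using \<open>K \<ge> 0\<close> \<open>e > 0\<close> by (simp add: R_def)
  have minint: "integrable M (\<lambda>x. min \<bar>w n x\<bar> R)" for n
    by (rule integrable_const_bound[of _ R]) (use \<open>R > 0\<close> in auto)
  have "(\<lambda>n. \<integral>x. min \<bar>w n x\<bar> R \<partial>M) \<longlonglongrightarrow> (\<integral>x. 0 \<partial>M)"
  proof (rule integral_dominated_convergence[of _ _ _ "\<lambda>_. R"])
    show "AE x in M. (\<lambda>n. min \<bar>w n x\<bar> R) \<longlonglongrightarrow> 0"
      using lim
    proof eventually_elim
      case (elim x)
      then have "(\<lambda>n. min \<bar>w n x\<bar> R) \<longlonglongrightarrow> min \<bar>0\<bar> R" by (intro tendsto_intros)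
      then show ?case using \<open>R > 0\<close> by simp
    qed
  qed (use \<open>R > 0\<close> in auto)
  then have "(\<lambda>n. \<integral>x. min \<bar>w n x\<bar> R \<partial>M) \<longlonglongrightarrow> 0" by simp
  from LIMSEQ_D[OF this half_gt_zero[OF \<open>e > 0\<close>]]
  obtain N where N: "\<And>n. n \<ge> N \<Longrightarrow> \<bar>\<integral>x. min \<bar>w n x\<bar> R \<partial>M\<bar> < e / 2"
    by auto
  have "norm ((\<integral>x. \<bar>w n x\<bar> \<partial>M) - 0) < e" if "n \<ge> N" for n
  proof -
    have "(\<integral>x. \<bar>w n x\<bar> \<partial>M) \<le> (\<integral>x. min \<bar>w n x\<bar> R + (w n x)\<^sup>2 / R \<partial>M)"
    proof (rule Bochner_Integration.integral_mono')
      show "integrable M (\<lambda>x. min \<bar>w n x\<bar> R + (w n x)\<^sup>2 / R)"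
        using minint int by auto
      show "\<bar>w n x\<bar> \<le> min \<bar>w n x\<bar> R + (w n x)\<^sup>2 / R" for x
      proof (cases "\<bar>w n x\<bar> \<le> R")
        case False
        then have "\<bar>w n x\<bar> * R \<le> \<bar>w n x\<bar> * \<bar>w n x\<bar>" by (intro mult_left_mono) auto
        then have "\<bar>w n x\<bar> \<le> (w n x)\<^sup>2 / R" using \<open>R > 0\<close> by (simp add: field_simps power2_eq_square)
        then show ?thesis using \<open>R > 0\<close> by linarith
      qed (use \<open>R > 0\<close> in auto)
    qed (use \<open>R > 0\<close> in auto)
    also have "\<dots> = (\<integral>x. min \<bar>w n x\<bar> R \<partial>M) + (\<integral>x. (w n x)\<^sup>2 \<partial>M) / R"
      using minint int by simp
    also have "\<dots> < e / 2 + K / R"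
      using N[OF that] K[of n] \<open>R > 0\<close> by (intro add_less_le_mono divide_right_mono) auto
    also have "\<dots> \<le> e"
      using \<open>e > 0\<close> \<open>K \<ge> 0\<close> by (simp add: R_def field_simps)
    finally show ?thesis by (simp add: integral_nonneg_AE)
  qed
  then show "\<exists>N. \<forall>n\<ge>N. norm ((\<integral>x. \<bar>w n x\<bar> \<partial>M) - 0) < e" by blast
qed

text \<open>Fatou is used twice over: a finite liminf of \<open>(u n x)^2\<close> excludes an
  infinite limit almost everywhere, and only then may the liminf be identified with the square of
  \<open>real_of_ereal (U x)\<close>, which inherits the bound \<open>K\<close>. The differences are
  then bounded by \<open>4 * K\<close> in square integral, and the preceding lemma applies.\<close>

lemma L2_bounded_pointwise_limit:
  fixes u :: "nat \<Rightarrow> 'a \<Rightarrow> real" and U :: "'a \<Rightarrow> ereal"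
  assumes fin: "finite_measure M" and um[measurable]: "\<And>n. u n \<in> borel_measurable M"
    and Um[measurable]: "U \<in> borel_measurable M"
    and int: "\<And>n. integrable M (\<lambda>x. (u n x)\<^sup>2)" and K: "\<And>n. (\<integral>x. (u n x)\<^sup>2 \<partial>M) \<le> K"
    and lim: "AE x in M. (\<lambda>n. ereal (u n x)) \<longlonglongrightarrow> U x"
  shows "AE x in M. \<bar>U x\<bar> \<noteq> \<infinity>" "integrable M (\<lambda>x. (real_of_ereal (U x))\<^sup>2)"
    "(\<lambda>n. \<integral>x. \<bar>u n x - real_of_ereal (U x)\<bar> \<partial>M) \<longlonglongrightarrow> 0"
proof -
  define f where "f x = real_of_ereal (U x)" for x
  have [measurable]: "f \<in> borel_measurable M" unfolding f_def by measurable
  have "0 \<le> (\<integral>x. (u 0 x)\<^sup>2 \<partial>M)" by simp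
  then have "K \<ge> 0" using K[of 0] by linarith
  have nnK: "(\<integral>\<^sup>+x. ennreal ((u n x)\<^sup>2) \<partial>M) \<le> ennreal K" for n
    using K[of n] int[of n] by (subst nn_integral_eq_integral) (auto simp: ennreal_leI)
  have "(\<integral>\<^sup>+x. liminf (\<lambda>n. ennreal ((u n x)\<^sup>2)) \<partial>M) \<le> liminf (\<lambda>n. \<integral>\<^sup>+x. ennreal ((u n x)\<^sup>2) \<partial>M)"
    by (rule nn_integral_liminf) measurable
  also have "\<dots> \<le> ennreal K"
    by (rule order_trans[OF Liminf_le_Limsup Limsup_bounded]) (simp_all add: nnK)
  finally have F: "(\<integral>\<^sup>+x. liminf (\<lambda>n. ennreal ((u n x)\<^sup>2)) \<partial>M) \<le> ennreal K" .
  then have ne: "(\<integral>\<^sup>+x. liminf (\<lambda>n. ennreal ((u n x)\<^sup>2)) \<partial>M) \<noteq> \<infinity>"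
    by (metis ennreal_neq_top infinity_ennreal_def neq_top_trans)
  have "AE x in M. liminf (\<lambda>n. ennreal ((u n x)\<^sup>2)) \<noteq> \<infinity>"
    by (rule nn_integral_noteq_infinite[OF _ ne]) measurable
  then have AEb: "AE x in M. \<bar>U x\<bar> \<noteq> \<infinity> \<and> (\<lambda>n. u n x) \<longlonglongrightarrow> f x"
    using lim
  proof eventually_elim
    case (elim x)
    have "\<bar>U x\<bar> \<noteq> \<infinity>"
    proof
      assume "\<bar>U x\<bar> = \<infinity>"
      moreover have "(\<lambda>n. \<bar>ereal (u n x)\<bar>) \<longlonglongrightarrow> \<bar>U x\<bar>"
        using elim(2) by (rule tendsto_abs_ereal)
      ultimately have "(\<lambda>n. ereal \<bar>u n x\<bar>) \<longlonglongrightarrow> \<infinity>" by simp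
      then have "filterlim (\<lambda>n. \<bar>u n x\<bar>) at_top sequentially"
        by (simp add: tendsto_PInfty_eq_at_top)
      then have "filterlim (\<lambda>n. \<bar>u n x\<bar> ^ 2) at_top sequentially"
        by (intro filterlim_pow_at_top) auto
      then have "(\<lambda>n. ennreal ((u n x)\<^sup>2)) \<longlonglongrightarrow> \<infinity>"
        by (simp add: ennreal_tendsto_top_eq_at_top)
      then show False using elim(1) lim_imp_Liminf[of sequentially "\<lambda>n. ennreal ((u n x)\<^sup>2)"] by auto
    qed
    then have "U x = ereal (f x)" by (simp add: f_def ereal_real')
    then show ?case using elim(2) \<open>\<bar>U x\<bar> \<noteq> \<infinity>\<close> by simp
  qed
  then show "AE x in M. \<bar>U x\<bar> \<noteq> \<infinity>" by eventually_elim auto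
  have "(\<integral>\<^sup>+x. ennreal ((f x)\<^sup>2) \<partial>M) = (\<integral>\<^sup>+x. liminf (\<lambda>n. ennreal ((u n x)\<^sup>2)) \<partial>M)"
  proof (rule nn_integral_cong_AE)
    show "AE x in M. ennreal ((f x)\<^sup>2) = liminf (\<lambda>n. ennreal ((u n x)\<^sup>2))"
      using AEb
    proof eventually_elim
      case (elim x)
      then have "(\<lambda>n. ennreal ((u n x)\<^sup>2)) \<longlonglongrightarrow> ennreal ((f x)\<^sup>2)"
        by (intro tendsto_ennrealI tendsto_intros) auto
      then show ?case using lim_imp_Liminf[OF sequentially_bot] by metis
    qed
  qed
  with F have f2K: "(\<integral>\<^sup>+x. ennreal ((f x)\<^sup>2) \<partial>M) \<le> ennreal K" by simp
  then have f2: "integrable M (\<lambda>x. (f x)\<^sup>2)"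
    by (intro integrableI_bounded) (auto intro: le_less_trans)
  then show "integrable M (\<lambda>x. (real_of_ereal (U x))\<^sup>2)" by (simp add: f_def)
  have f2K': "(\<integral>x. (f x)\<^sup>2 \<partial>M) \<le> K"
    using f2K f2 \<open>K \<ge> 0\<close> by (subst (asm) nn_integral_eq_integral) auto
  have dom: "(u n x - f x)\<^sup>2 \<le> 2 * (u n x)\<^sup>2 + 2 * (f x)\<^sup>2" for n x
    using zero_le_power2[of "u n x + f x"] by (simp add: power2_sum power2_diff)
  have "(\<lambda>n. \<integral>x. \<bar>u n x - f x\<bar> \<partial>M) \<longlonglongrightarrow> 0"
  proof (rule AE_L2_bounded_imp_L1[OF fin])
    show i: "integrable M (\<lambda>x. (u n x - f x)\<^sup>2)" for n
      by (rule Bochner_Integration.integrable_bound[of _ "\<lambda>x. 2 * (u n x)\<^sup>2 + 2 * (f x)\<^sup>2"])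
        (use int f2 dom in auto)
    have "(\<integral>x. (u n x - f x)\<^sup>2 \<partial>M) \<le> (\<integral>x. 2 * (u n x)\<^sup>2 + 2 * (f x)\<^sup>2 \<partial>M)" for n
      by (rule integral_mono) (use int f2 i dom in auto)
    also have "(\<integral>x. 2 * (u n x)\<^sup>2 + 2 * (f x)\<^sup>2 \<partial>M) \<le> 4 * K" for n
      using int[of n] f2 K[of n] f2K' by simp
    finally show "(\<integral>x. (u n x - f x)\<^sup>2 \<partial>M) \<le> 4 * K" for n .
    show "AE x in M. (\<lambda>n. u n x - f x) \<longlonglongrightarrow> 0"
      using AEb by eventually_elim (auto simp: LIM_zero_iff)
  qed measurable
  then show "(\<lambda>n. \<integral>x. \<bar>u n x - real_of_ereal (U x)\<bar> \<partial>M) \<longlonglongrightarrow> 0" by (simp add: f_def)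
qed

subsection \<open>Weak derivatives of indefinite integrals\<close>

lemma integrable_tensor_product:
  fixes f g :: "real \<Rightarrow> real"
  assumes f: "integrable lborel f" and g: "integrable lborel g"
  shows "integrable (lborel \<Otimes>\<^sub>M lborel) (\<lambda>(x, y). f x * g y)"
proof (rule lborel_pair.Fubini_integrable)
  have [measurable]: "f \<in> borel_measurable borel" "g \<in> borel_measurable borel"
    using f g by auto
  show "(\<lambda>(x, y). f x * g y) \<in> borel_measurable (lborel \<Otimes>\<^sub>M lborel)"
    by measurable
  show "integrable lborel (\<lambda>x. \<integral>y. norm (case (x, y) of (x, y) \<Rightarrow> f x * g y) \<partial>lborel)"
    using f by (simp add: abs_mult)
qed (use g in auto)

text \<open>As \<open>w\<close> is merely integrable, integration by parts is replaced by Fubini on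
  the triangle t < x: integrating \<open>deriv \<psi>\<close> from t to \<open>L\<close> leaves
  \<open>- \<psi> t\<close>, because \<open>\<psi>\<close> vanishes at \<open>L\<close>.\<close>

lemma weak_deriv_on_indefinite_integral:
  fixes v w :: "real \<Rightarrow> real"
  assumes w: "set_integrable lborel {0<..<L} w"
    and v: "\<And>x. x \<in> {0<..<L} \<Longrightarrow> v x = (LINT t:{0<..<x}|lborel. w t)"
  shows "weak_deriv_on L v w"
  unfolding weak_deriv_on_def
proof (intro allI impI)
  fix \<psi> assume \<psi>: "test_fun L \<psi>"
  obtain d where d: "d < L" "\<And>x. x \<notin> {..d} \<Longrightarrow> \<psi> x = 0"
    using \<psi> by (fastforce simp: test_fun_def)
  have "\<psi> L = 0" using d by simp
  have diff: "((deriv ^^ k) \<psi>) differentiable (at x)" for k x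
    using \<psi> by (simp add: test_fun_def)
  have der: "(\<psi> has_real_derivative deriv \<psi> x) (at x)" for x
    using diff[of 0 x] DERIV_deriv_iff_real_differentiable by auto
  have cont: "isCont (deriv \<psi>) x" for x
    using diff[of 1 x] by (auto intro: differentiable_imp_continuous_within)
  define W where "W t = indicator {0<..<L} t * w t" for t
  define P where "P x = deriv \<psi> x * indicator {0<..<L} x" for x
  \<comment> \<open>Integrating over \<open>t\<close> first yields
    \<open>v x * deriv \<psi> x\<close>; integrating over \<open>x\<close> first yields
    \<open>- (w t * \<psi> t)\<close>.\<close>
  define f where "f x t = indicator {p. fst p < snd p} (t, x) * (P x * W t)" for x t :: real
  have W: "integrable lborel W"
    using w by (simp add: set_integrable_def W_def[abs_def])
  have P: "integrable lborel P"
    unfolding P_def[abs_def]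
    using set_integrable_subset[OF borel_integrable_atLeastAtMost'[of 0 L "deriv \<psi>"], of "{0<..<L}"] cont
    by (simp add: continuous_at_imp_continuous_on set_integrable_def mult.commute greaterThanLessThan_subseteq_atLeastAtMost_iff)
  have [measurable]: "W \<in> borel_measurable borel" "P \<in> borel_measurable borel"
    using W P by auto
  have fint: "integrable (lborel \<Otimes>\<^sub>M lborel) (case_prod f)"
  proof (rule Bochner_Integration.integrable_bound[OF integrable_tensor_product[OF P W]])
    have "{p :: real \<times> real. fst p < snd p} \<in> sets (borel \<Otimes>\<^sub>M borel)"
      unfolding borel_prod by (intro borel_open open_Collect_less continuous_intros)
    then show "case_prod f \<in> borel_measurable (lborel \<Otimes>\<^sub>M lborel)"
      unfolding f_def[abs_def] by measurable
  qed (auto simp: f_def indicator_def)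
  have "(LINT x:{0<..<L}|lborel. v x * deriv \<psi> x) = (\<integral>x. (\<integral>t. f x t \<partial>lborel) \<partial>lborel)"
    unfolding set_lebesgue_integral_def
  proof (rule Bochner_Integration.integral_cong)
    show "indicator {0<..<L} x *\<^sub>R (v x * deriv \<psi> x) = (\<integral>t. f x t \<partial>lborel)" for x
    proof (cases "x \<in> {0<..<L}")
      case True
      have "(\<integral>t. f x t \<partial>lborel) = (\<integral>t. deriv \<psi> x * (indicator {0<..<x} t *\<^sub>R w t) \<partial>lborel)"
        by (rule Bochner_Integration.integral_cong)
          (use True in \<open>auto simp: f_def P_def W_def indicator_def\<close>)
      also have "\<dots> = deriv \<psi> x * v x"
        by (simp add: v[OF True] set_lebesgue_integral_def)
      finally show ?thesis using True by simp
    qed (simp add: f_def P_def)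
  qed simp
  also have "\<dots> = (\<integral>t. (\<integral>x. f x t \<partial>lborel) \<partial>lborel)"
    using lborel_pair.Fubini_integral[OF fint] by simp
  also have "\<dots> = (\<integral>t. - (indicator {0<..<L} t *\<^sub>R (w t * \<psi> t)) \<partial>lborel)"
  proof (rule Bochner_Integration.integral_cong)
    fix t
    show "(\<integral>x. f x t \<partial>lborel) = - (indicator {0<..<L} t *\<^sub>R (w t * \<psi> t))"
    proof (cases "t \<in> {0<..<L}")
      case True
      \<comment> \<open>Passing to the closed interval required by the fundamental theorem changes
        the integrand at most at \<open>t\<close> and \<open>L\<close>.\<close>
      have "(\<integral>x. f x t \<partial>lborel) = (\<integral>x. W t * (deriv \<psi> x * indicator {t..L} x) \<partial>lborel)"
      proof (rule integral_cong_AE)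
        show "AE x in lborel. f x t = W t * (deriv \<psi> x * indicator {t..L} x)"
          using AE_lborel_singleton[of t] AE_lborel_singleton[of L]
          by eventually_elim (use True in \<open>auto simp: f_def P_def indicator_def\<close>)
        show "(\<lambda>x. f x t) \<in> borel_measurable lborel"
          using fint by measurable
        show "(\<lambda>x. W t * (deriv \<psi> x * indicator {t..L} x)) \<in> borel_measurable lborel"
          using cont by (intro borel_measurable_times) (auto intro!: borel_measurable_continuous_onI continuous_at_imp_continuous_on)
      qed
      also have "\<dots> = W t * (\<psi> L - \<psi> t)"
        using integral_FTC_Icc_real[of t L \<psi> "deriv \<psi>"] True der cont by simp
      finally show ?thesis using True \<open>\<psi> L = 0\<close> by (simp add: W_def)
    qed (simp add: f_def W_def)
  qed simp
  also have "\<dots> = - (LINT x:{0<..<L}|lborel. w x * \<psi> x)"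
    unfolding set_lebesgue_integral_def by simp
  finally show "(LINT x:{0<..<L}|lborel. v x * deriv \<psi> x) = - (LINT x:{0<..<L}|lborel. w x * \<psi> x)" .
qed

subsection \<open>Truncation of the nonlinearity\<close>

text \<open>The cut is taken before the conversion, so an infinite value becomes \<open>n\<close>
  and not the default 0. Cutting from above is enough to make the values finite, since
  \<open>H_phi\<close> excludes minus infinity.\<close>

definition truncated :: "(real \<Rightarrow> ereal) \<Rightarrow> nat \<Rightarrow> real \<Rightarrow> real" where
  "truncated \<phi> n s = real_of_ereal (min (\<phi> s) (ereal n))"

lemma ereal_truncated:
  assumes "H_phi \<phi>"
  shows "ereal (truncated \<phi> n s) = min (\<phi> s) (ereal n)"
  using assms unfolding truncated_def H_phi_def by (cases "\<phi> s") (auto simp: min_def)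

lemma continuous_truncated:
  assumes "H_phi \<phi>"
  shows "continuous_on UNIV (truncated \<phi> n)"
proof -
  have "continuous_on UNIV (\<lambda>s. min (\<phi> s) (ereal n))"
    using assms by (intro continuous_intros) (simp add: H_phi_def)
  moreover have "\<bar>min (\<phi> s) (ereal n)\<bar> \<noteq> \<infinity>" for s
    unfolding ereal_truncated[OF assms, symmetric] by simp
  ultimately show ?thesis
    by (subst (asm) continuous_on_iff_real) (auto simp: truncated_def[abs_def] comp_def)
qed

text \<open>As the cut level is nonnegative, cutting moves large positive values towards 0 and
  leaves negative ones alone; a bound on \<open>\<phi>\<close> thus passes to all truncations with
  the same constant.\<close>

lemma abs_truncated_le:
  assumes "H_phi \<phi>" "\<bar>\<phi> s\<bar> \<le> ereal M"
  shows "\<bar>truncated \<phi> n s\<bar> \<le> M"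
  using assms unfolding truncated_def by (cases "\<phi> s") (auto simp: min_def)

text \<open>Compactness near 0, \<open>H_bdd\<close> elsewhere. The bound may grow with
  \<open>n\<close>; it serves only the scheme and integrability at a fixed \<open>n\<close>.\<close>

lemma bounded_truncated:
  assumes "H_phi \<phi>" "H_bdd \<phi>"
  obtains B where "\<And>s. \<bar>truncated \<phi> n s\<bar> \<le> B"
proof -
  obtain M where M: "\<And>s. 1 \<le> \<bar>s\<bar> \<Longrightarrow> \<bar>\<phi> s\<bar> \<le> ereal M"
    using assms(2) unfolding H_bdd_def by (metis zero_less_one)
  have "compact (truncated \<phi> n ` {-1..1})"
    by (intro compact_continuous_image continuous_on_subset[OF continuous_truncated[OF assms(1)]]) auto
  then obtain B where B: "\<forall>s\<in>{-1..1}. \<bar>truncated \<phi> n s\<bar> \<le> B"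
    by (auto dest!: compact_imp_bounded simp: bounded_iff)
  have "\<bar>truncated \<phi> n s\<bar> \<le> max B M" for s
  proof (cases "s \<in> {-1..1}")
    case True
    then show ?thesis using bspec[OF B True] by simp
  next
    case False
    then have "\<bar>truncated \<phi> n s\<bar> \<le> M" by (intro abs_truncated_le assms M) auto
    then show ?thesis by simp
  qed
  then show thesis using that by blast
qed

text \<open>Away from 0 all truncations are dominated by one integrable function \<open>G\<close>
  plus one constant \<open>M\<close>, so the constants precede \<open>n\<close>: \<open>C0\<close>
  is the integral of \<open>G\<close> and \<open>C1\<close> is \<open>M\<close>.\<close>

lemma primitive_truncated_growth:
  assumes "H_phi \<phi>" "H_int \<phi>" "H_bdd \<phi>"
  obtains C0 C1 where "C1 \<ge> 0"
    "\<And>n F y. (\<And>s. (F has_real_derivative truncated \<phi> n s) (at s)) \<Longrightarrow> F y - F 0 \<le> C0 + C1 * \<bar>y\<bar>"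
proof -
  obtain M where M: "\<And>s. 1 / 2 \<le> \<bar>s\<bar> \<Longrightarrow> \<bar>\<phi> s\<bar> \<le> ereal M"
    using assms(3) unfolding H_bdd_def by (metis half_gt_zero_iff zero_less_one)
  have "0 \<le> \<bar>\<phi> 1\<bar>" by simp
  also have "\<dots> \<le> ereal M" using M[of 1] by simp
  finally have "M \<ge> 0" by simp
  define f where "f t = real_of_ereal (\<phi> t)" for t
  \<comment> \<open>The two pieces are those of \<open>H_int\<close> with radius 1/2. The point 0 is
    left out: there the truncation may equal \<open>n\<close>, which no bound uniform in
    \<open>n\<close> covers, but it is a null set.\<close>
  define G where "G t = \<bar>indicator {-1/2<..<0} t * f t\<bar> + \<bar>indicator {0<..<1/2} t * f t\<bar>" for t :: real
  have "set_integrable lborel {0<..<1/2} f" "set_integrable lborel {-(1/2)<..<0} f"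
    using assms(2)[unfolded H_int_def, rule_format, of "1/2"] by (auto simp: f_def[abs_def])
  then have G: "integrable lborel G"
    unfolding G_def[abs_def] set_integrable_def by (intro Bochner_Integration.integrable_add integrable_abs) auto
  have bound: "\<bar>truncated \<phi> n s\<bar> \<le> G s + M" if "s \<noteq> 0" for n s
  proof (cases "1 / 2 \<le> \<bar>s\<bar>")
    case True
    then show ?thesis using abs_truncated_le[OF assms(1) M[OF True], of n] by (simp add: G_def)
  next
    case False
    then have "G s = \<bar>f s\<bar>" using that by (auto simp: G_def indicator_def)
    moreover have "\<phi> s = ereal (f s)"
      using assms(1) that by (cases "\<phi> s") (auto simp: H_phi_def f_def)
    then have "\<bar>truncated \<phi> n s\<bar> \<le> \<bar>f s\<bar>" by (intro abs_truncated_le[OF assms(1)]) simp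
    ultimately show ?thesis using \<open>M \<ge> 0\<close> by linarith
  qed
  have incr: "\<bar>F q - F p\<bar> \<le> (\<integral>t. G t \<partial>lborel) + M * (q - p)"
    if F: "\<And>s. (F has_real_derivative truncated \<phi> n s) (at s)" and "p \<le> q" for F n p q
  proof -
    have tr: "isCont (truncated \<phi> n) s" for s
      using continuous_truncated[OF assms(1)] by (simp add: continuous_on_eq_continuous_at)
    have hb: "has_bochner_integral lborel (\<lambda>x. truncated \<phi> n x * indicator {p..q} x) (F q - F p)"
      by (rule has_bochner_integral_FTC_Icc_real[OF \<open>p \<le> q\<close> F tr])
    then have "\<bar>F q - F p\<bar> = \<bar>\<integral>x. truncated \<phi> n x * indicator {p..q} x \<partial>lborel\<bar>"
      by (simp add: has_bochner_integral_iff)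
    also have "\<dots> \<le> (\<integral>x. G x + M * indicator {p..q} x \<partial>lborel)"
    proof (rule order_trans[OF integral_abs_bound], rule integral_mono_AE)
      show "AE x in lborel. \<bar>truncated \<phi> n x * indicator {p..q} x\<bar> \<le> G x + M * indicator {p..q} x"
        using AE_lborel_singleton[of 0]
      proof eventually_elim
        case (elim x)
        have "G x \<ge> 0" by (simp add: G_def)
        then show ?case using bound[OF elim, of n] by (auto simp: indicator_def)
      qed
    qed (use hb G \<open>p \<le> q\<close> in \<open>auto simp: has_bochner_integral_iff\<close>)
    also have "\<dots> = (\<integral>t. G t \<partial>lborel) + M * (q - p)"
      using G \<open>p \<le> q\<close> by simp
    finally show ?thesis .
  qed
  have "F y - F 0 \<le> (\<integral>t. G t \<partial>lborel) + M * \<bar>y\<bar>"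
    if F: "\<And>s. (F has_real_derivative truncated \<phi> n s) (at s)" for n F y
    using incr[OF F, of 0 y] incr[OF F, of y 0] by (cases "y \<ge> 0") auto
  then show thesis using that \<open>M \<ge> 0\<close> by blast
qed

text \<open>Argument and cut level move together. Working in \<open>ereal\<close> covers a zero of
  the limit where \<open>\<phi>\<close> is infinite: \<open>min\<close> is continuous there and the
  levels tend to infinity.\<close>

lemma truncated_tendsto:
  assumes "H_phi \<phi>" "z \<longlonglongrightarrow> s" "filterlim r at_top sequentially"
  shows "(\<lambda>n. ereal (truncated \<phi> (r n) (z n))) \<longlonglongrightarrow> \<phi> s"
proof -
  have "isCont \<phi> s" using assms(1) by (simp add: H_phi_def continuous_on_eq_continuous_at)
  then have "(\<lambda>n. \<phi> (z n)) \<longlonglongrightarrow> \<phi> s" using assms(2) by (simp add: isCont_tendsto_compose)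
  moreover have "(\<lambda>n. ereal (real (r n))) \<longlonglongrightarrow> \<infinity>"
    unfolding tendsto_PInfty_eq_at_top
    using filterlim_compose[OF filterlim_real_sequentially assms(3)] by simp
  ultimately have "(\<lambda>n. min (\<phi> (z n)) (ereal (r n))) \<longlonglongrightarrow> min (\<phi> s) \<infinity>"
    by (rule tendsto_min)
  then show ?thesis by (simp add: ereal_truncated[OF assms(1)] min_def)
qed

text \<open>Young's inequality
  \<open>\<bar>f\<bar> \<le> \<theta> * f^2 + 1 / (4 * \<theta>)\<close> plays the role of
  Cauchy-Schwarz; the free parameter \<open>\<theta>\<close> makes the first term small before the
  length \<open>y - x\<close> does the same for the second.\<close>

lemma integral_mult_bounded_le:
  fixes f b :: "real \<Rightarrow> real"
  assumes fm[measurable]: "f \<in> borel_measurable borel" and [measurable]: "b \<in> borel_measurable borel"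
    and f2: "set_integrable lborel {0..L} (\<lambda>t. (f t)\<^sup>2)" and b: "\<And>t. \<bar>b t\<bar> \<le> C"
    and xy: "0 \<le> x" "x \<le> y" "y \<le> L" and "\<theta> > 0"
  shows "(\<lambda>t. f t * b t) integrable_on {0..L}"
    and "\<bar>integral {0..y} (\<lambda>t. f t * b t) - integral {0..x} (\<lambda>t. f t * b t)\<bar>
      \<le> C * (\<theta> * integral {0..L} (\<lambda>t. (f t)\<^sup>2) + (y - x) / (4 * \<theta>))"
proof -
  have C: "C \<ge> 0" using b[of 0] by linarith
  note f1 = set_integrable_abs_of_square[OF fm f2]
  show io: "(\<lambda>t. f t * b t) integrable_on {0..L}"
    by (rule integrable_on_dominated(2)[of _ _ _ "\<lambda>t. \<bar>f t\<bar> * C"])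
      (use b in \<open>auto simp: abs_mult intro!: mult_left_mono set_integrable_mult_left[OF f1]\<close>)
  have f2io: "(\<lambda>t. (f t)\<^sup>2) integrable_on {0..L}"
    using set_borel_integral_eq_integral(1)[OF f2] .
  have sub: "k integrable_on {p..q}" if "k integrable_on {0..L}" "0 \<le> p" "q \<le> L"
    for k :: "real \<Rightarrow> real" and p q
    by (rule integrable_on_subinterval[OF that(1)]) (use that in auto)
  have pt: "\<bar>f t * b t\<bar> \<le> C * (\<theta> * (f t)\<^sup>2 + 1 / (4 * \<theta>))" for t
  proof -
    have "a \<le> \<theta> * a\<^sup>2 + 1 / (4 * \<theta>)" for a
    proof -
      have "\<theta> * a\<^sup>2 + 1 / (4 * \<theta>) - a = \<theta> * (a - 1 / (2 * \<theta>))\<^sup>2"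
        using \<open>\<theta> > 0\<close> by (simp add: power2_eq_square field_simps)
      also have "\<dots> \<ge> 0" using \<open>\<theta> > 0\<close> by simp
      finally show ?thesis by simp
    qed
    from this[of "\<bar>f t\<bar>"] have "\<bar>f t\<bar> \<le> \<theta> * (f t)\<^sup>2 + 1 / (4 * \<theta>)" by simp
    then have "\<bar>f t\<bar> * \<bar>b t\<bar> \<le> (\<theta> * (f t)\<^sup>2 + 1 / (4 * \<theta>)) * C"
      using b[of t] \<open>\<theta> > 0\<close> by (intro mult_mono) auto
    then show ?thesis by (simp add: abs_mult mult.commute)
  qed
  have "integral {0..y} (\<lambda>t. f t * b t) - integral {0..x} (\<lambda>t. f t * b t) = integral {x..y} (\<lambda>t. f t * b t)"
    using Henstock_Kurzweil_Integration.integral_combine[of 0 x y "\<lambda>t. f t * b t"] xy sub[OF io, of 0 y] by simp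
  moreover have "norm (integral {x..y} (\<lambda>t. f t * b t)) \<le> integral {x..y} (\<lambda>t. C * (\<theta> * (f t)\<^sup>2 + 1 / (4 * \<theta>)))"
    by (rule integral_norm_bound_integral)
      (use pt xy sub[OF io] sub[OF f2io] in \<open>auto intro!: integrable_on_mult_right integrable_add\<close>)
  moreover have "integral {x..y} (\<lambda>t. C * (\<theta> * (f t)\<^sup>2 + 1 / (4 * \<theta>)))
      = C * (\<theta> * integral {x..y} (\<lambda>t. (f t)\<^sup>2) + (y - x) / (4 * \<theta>))"
    using xy sub[OF f2io, of x y]
    by (simp add: Henstock_Kurzweil_Integration.integral_add[OF integrable_on_mult_right integrable_const_ivl])
  moreover have "\<dots> \<le> C * (\<theta> * integral {0..L} (\<lambda>t. (f t)\<^sup>2) + (y - x) / (4 * \<theta>))"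
    using C \<open>\<theta> > 0\<close> xy sub[OF f2io, of x y] f2io
    by (intro mult_left_mono add_mono integral_subset_le) auto
  ultimately show "\<bar>integral {0..y} (\<lambda>t. f t * b t) - integral {0..x} (\<lambda>t. f t * b t)\<bar>
      \<le> C * (\<theta> * integral {0..L} (\<lambda>t. (f t)\<^sup>2) + (y - x) / (4 * \<theta>))"
    unfolding real_norm_def by linarith
qed

subsection \<open>Passage to the limit\<close>

lemma lborel_restrict_conv:
  fixes f :: "real \<Rightarrow> real"
  shows "integrable (restrict_space lborel {p..q}) f \<longleftrightarrow> set_integrable lborel {p..q} f"
    and "integral\<^sup>L (restrict_space lborel {p..q}) f = (LINT x:{p..q}|lborel. f x)"
  by (simp_all add: integrable_restrict_space integral_restrict_space set_integrable_def set_lebesgue_integral_def)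

lemma equibounded_derivative_subsequence:
  fixes f :: "nat \<Rightarrow> real \<Rightarrow> real" and b :: "real \<Rightarrow> real"
  assumes "L > 0" and [measurable]: "\<And>n. f n \<in> borel_measurable borel"
    and [measurable]: "b \<in> borel_measurable borel"
    and f2: "\<And>n. set_integrable lborel {0..L} (\<lambda>t. (f n t)\<^sup>2)"
    and K: "\<And>n. integral {0..L} (\<lambda>t. (f n t)\<^sup>2) \<le> K" and b: "\<And>t. \<bar>b t\<bar> \<le> C"
  obtains V r where "continuous_on {0..L} V" "strict_mono (r :: nat \<Rightarrow> nat)"
    "\<And>x. x \<in> {0..L} \<Longrightarrow> (\<lambda>n. integral {0..x} (\<lambda>t. f (r n) t * b t)) \<longlonglongrightarrow> V x"
proof -
  define v where "v n x = integral {0..x} (\<lambda>t. f n t * b t)" for n x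
  have "C \<ge> 0" using b[of 0] by linarith
  have "0 \<le> integral {0..L} (\<lambda>t. (f 0 t)\<^sup>2)"
    by (rule integral_nonneg[OF set_borel_integral_eq_integral(1)[OF f2]]) simp
  then have "K \<ge> 0" using K[of 0] by linarith
  have bd: "\<bar>v n y - v n x\<bar> \<le> C * (\<theta> * K + (y - x) / (4 * \<theta>))"
    if "0 \<le> x" "x \<le> y" "y \<le> L" "\<theta> > 0" for n x y \<theta>
  proof -
    have "\<bar>v n y - v n x\<bar> \<le> C * (\<theta> * integral {0..L} (\<lambda>t. (f n t)\<^sup>2) + (y - x) / (4 * \<theta>))"
      unfolding v_def by (rule integral_mult_bounded_le(2)[OF _ _ f2 b that]) measurable
    also have "\<dots> \<le> C * (\<theta> * K + (y - x) / (4 * \<theta>))"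
      using \<open>C \<ge> 0\<close> K[of n] that by (intro mult_left_mono add_right_mono) auto
    finally show ?thesis .
  qed
  have bd': "\<bar>v n x - v n y\<bar> \<le> C * (\<theta> * K + \<bar>x - y\<bar> / (4 * \<theta>))"
    if "x \<in> {0..L}" "y \<in> {0..L}" "\<theta> > 0" for n x y \<theta>
    using bd[of x y \<theta> n] bd[of y x \<theta> n] that by (cases "x \<le> y") (auto simp: abs_minus_commute)
  have cp: "compact {0..L}" by simp
  have M: "norm (v n x) \<le> C * (K + L / 4)" if "x \<in> {0..L}" for n x
  proof -
    have "\<bar>v n x - v n 0\<bar> \<le> C * (1 * K + \<bar>x - 0\<bar> / (4 * 1))" using that by (intro bd') auto
    also have "\<dots> \<le> C * (K + L / 4)" using that \<open>C \<ge> 0\<close> by (intro mult_left_mono) auto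
    finally show ?thesis by (simp add: v_def)
  qed
  have eqc: "\<exists>d. 0 < d \<and> (\<forall>n y. y \<in> {0..L} \<and> norm (x - y) < d \<longrightarrow> norm (v n x - v n y) < e)"
    if x: "x \<in> {0..L}" and "0 < e" for x e
  proof -
    \<comment> \<open>Strictly positive upper bounds for \<open>C\<close> and \<open>K\<close>,
      which may vanish, allow division. The choices of \<open>\<theta>\<close> and \<open>d\<close>
      make the two error terms \<open>e / 2\<close> and \<open>e / 4\<close>.\<close>
    obtain p q where pq: "p > 0" "q > 0" "C \<le> p" "K \<le> q"
      by (rule that[of "C + 1" "K + 1"]) (use \<open>C \<ge> 0\<close> \<open>K \<ge> 0\<close> in auto)
    define \<theta> where "\<theta> = e / (2 * p * q)"
    define d where "d = \<theta> * e / p"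
    have "\<theta> > 0" using \<open>0 < e\<close> pq by (simp add: \<theta>_def)
    then have "d > 0" using \<open>0 < e\<close> pq by (simp add: d_def)
    have "norm (v n x - v n y) < e" if y: "y \<in> {0..L}" "norm (x - y) < d" for n y
    proof -
      have "\<bar>v n x - v n y\<bar> \<le> C * (\<theta> * K + \<bar>x - y\<bar> / (4 * \<theta>))"
        by (rule bd'[OF x y(1) \<open>\<theta> > 0\<close>])
      also have "\<dots> \<le> C * (\<theta> * K + d / (4 * \<theta>))"
        using y \<open>C \<ge> 0\<close> \<open>\<theta> > 0\<close> by (intro mult_left_mono add_left_mono divide_right_mono) auto
      also have "\<dots> \<le> p * (\<theta> * q + d / (4 * \<theta>))"
        using \<open>C \<ge> 0\<close> \<open>\<theta> > 0\<close> \<open>K \<ge> 0\<close> \<open>d > 0\<close> pq by (intro mult_mono add_mono) auto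
      also have "\<dots> = e / 2 + e / 4"
      proof -
        have "p * (\<theta> * q) = e / 2" "p * (d / (4 * \<theta>)) = e / 4"
          using pq \<open>\<theta> > 0\<close> by (auto simp: \<theta>_def d_def)
        then show ?thesis by (simp only: distrib_left)
      qed
      also have "\<dots> < e" using \<open>0 < e\<close> by simp
      finally show ?thesis by simp
    qed
    then show ?thesis using \<open>d > 0\<close> by blast
  qed
  obtain V r where V: "continuous_on {0..L} V" "strict_mono (r :: nat \<Rightarrow> nat)"
      "\<And>e. 0 < e \<Longrightarrow> \<exists>N. \<forall>n x. n \<ge> N \<and> x \<in> {0..L} \<longrightarrow> norm (v (r n) x - V x) < e"
    using Arzela_Ascoli[OF cp M eqc] by blast
  have "(\<lambda>n. v (r n) x) \<longlonglongrightarrow> V x" if "x \<in> {0..L}" for x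
    by (rule LIMSEQ_I) (use V(3) that in blast)
  then show thesis using that[OF V(1,2)] by (simp add: v_def)
qed

text \<open>The bound \<open>K\<close> is fixed before \<open>n\<close>: the growth constants of the
  primitives do not depend on the truncation, and the energy bound contains neither the sup norm of
  the truncation nor the tolerance.\<close>

lemma approximate_solutions:
  fixes h b :: "real \<Rightarrow> real"
  assumes L: "L > 0" and hm: "h \<in> borel_measurable borel"
    and bm: "b \<in> borel_measurable borel"
    and h2: "set_integrable lborel {0..L} (\<lambda>t. (h t)\<^sup>2)"
    and c: "0 < c" and b: "\<And>t. c \<le> b t" "\<And>t. b t \<le> C"
    and \<phi>: "H_phi \<phi>" "H_int \<phi>" "H_bdd \<phi>"
  obtains K z where "\<And>n. z n \<in> borel_measurable borel"
    "\<And>n t. t \<in> {0..<L} \<Longrightarrow>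
      \<bar>z n t - integral {0..t} (\<lambda>s. (truncated \<phi> n (z n s) + h s) * b s)\<bar> \<le> inverse (real (Suc n))"
    "\<And>n. integral {0..L} (\<lambda>t. (truncated \<phi> n (z n t))\<^sup>2) \<le> K"
proof -
  obtain C0 C1 where C1: "C1 \<ge> 0" and
    gr: "\<And>n F y. (\<And>s. (F has_real_derivative truncated \<phi> n s) (at s)) \<Longrightarrow> F y - F 0 \<le> C0 + C1 * \<bar>y\<bar>"
    using primitive_truncated_growth[OF \<phi>] by metis
  define K where "K = (2 * C0 + integral {0..L} (\<lambda>t. 4 * ((h t)\<^sup>2 + (C1 + 1)\<^sup>2) * C)) / c"
  define Q where "Q n z \<longleftrightarrow> z \<in> borel_measurable borel \<and> (\<forall>t\<in>{0..<L}.
      \<bar>z t - integral {0..t} (\<lambda>s. (truncated \<phi> n (z s) + h s) * b s)\<bar> \<le> inverse (real (Suc n)))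
    \<and> integral {0..L} (\<lambda>t. (truncated \<phi> n (z t))\<^sup>2) \<le> K" for n z
  have "\<exists>z. Q n z" for n
  proof -
    note cont = continuous_truncated[OF \<phi>(1), of n]
    obtain B where B: "\<And>s. \<bar>truncated \<phi> n s\<bar> \<le> B"
      using bounded_truncated[OF \<phi>(1,3)] by blast
    have "isCont (truncated \<phi> n) x" for x using cont by (simp add: continuous_on_eq_continuous_at)
    then obtain F where F: "\<And>s. (F has_real_derivative truncated \<phi> n s) (at s)"
      using einterval_antiderivative[of "-\<infinity>" "\<infinity>" "truncated \<phi> n"]
      by (auto simp: has_real_derivative_iff_has_vector_derivative)
    obtain z where "z \<in> borel_measurable borel"
      "\<And>t. t \<in> {0..<L} \<Longrightarrow> \<bar>z t - integral {0..t} (\<lambda>s. (truncated \<phi> n (z s) + h s) * b s)\<bar>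
        \<le> inverse (real (Suc n))"
      "integral {0..L} (\<lambda>t. (truncated \<phi> n (z t))\<^sup>2) \<le> K"
      unfolding K_def
      by (rule euler_scheme_energy[OF L hm bm h2 c b cont B F gr[OF F] C1, of "inverse (real (Suc n))"],
          simp, rule that[unfolded K_def])
    then show ?thesis unfolding Q_def by blast
  qed
  then obtain z where "\<And>n. Q n (z n)" by metis
  then show thesis by (intro that[of z K]) (simp_all add: Q_def)
qed

lemma integral_equation_solvable:
  fixes h b :: "real \<Rightarrow> real"
  assumes L: "L > 0" and hm[measurable]: "h \<in> borel_measurable borel"
    and bm[measurable]: "b \<in> borel_measurable borel"
    and h2: "set_integrable lborel {0..L} (\<lambda>t. (h t)\<^sup>2)"
    and c: "0 < c" and b: "\<And>t. c \<le> b t" "\<And>t. b t \<le> C"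
    and \<phi>: "H_phi \<phi>" "H_int \<phi>" "H_bdd \<phi>"
  obtains V where "continuous_on UNIV V" "V 0 = 0"
    "AE x in lborel. x \<in> {0..L} \<longrightarrow> \<phi> (V x) \<noteq> \<infinity>"
    "set_integrable lborel {0..L} (\<lambda>x. (real_of_ereal (\<phi> (V x)))\<^sup>2)"
    "\<And>x. x \<in> {0..L} \<Longrightarrow> V x = integral {0..x} (\<lambda>t. (real_of_ereal (\<phi> (V t)) + h t) * b t)"
proof -
  obtain K z where zm[measurable]: "\<And>n. z n \<in> borel_measurable borel"
    and z: "\<And>n t. t \<in> {0..<L} \<Longrightarrow>
      \<bar>z n t - integral {0..t} (\<lambda>s. (truncated \<phi> n (z n s) + h s) * b s)\<bar> \<le> inverse (real (Suc n))"
    and K: "\<And>n. integral {0..L} (\<lambda>t. (truncated \<phi> n (z n t))\<^sup>2) \<le> K"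
    by (rule approximate_solutions[OF assms]) (rule that)
  have bC: "\<bar>b t\<bar> \<le> C" for t using b[of t] c by linarith
  define u where "u n t = truncated \<phi> n (z n t)" for n t
  have [measurable]: "truncated \<phi> n \<in> borel_measurable borel" for n
    by (rule borel_measurable_continuous_onI[OF continuous_truncated[OF \<phi>(1)]])
  have um[measurable]: "u n \<in> borel_measurable borel" for n
    unfolding u_def by measurable
  have u2: "set_integrable lborel {0..L} (\<lambda>t. (u n t)\<^sup>2)" for n
  proof -
    obtain B where B: "\<And>s. \<bar>truncated \<phi> n s\<bar> \<le> B"
      using bounded_truncated[OF \<phi>(1,3)] by blast
    show ?thesis
    proof (rule integrable_on_dominated(1))
      show "set_integrable lborel {0..L} (\<lambda>t. B\<^sup>2)"
        by (rule borel_integrable_atLeastAtMost'[OF continuous_on_const])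
      show "\<bar>(u n t)\<^sup>2\<bar> \<le> B\<^sup>2" for t
        using power_mono[OF B[of "z n t"], of 2] by (simp add: u_def)
    qed measurable
  qed
  define H where "H = integral {0..L} (\<lambda>t. (h t)\<^sup>2)"
  have sq: "(u n t + h t)\<^sup>2 \<le> 2 * (u n t)\<^sup>2 + 2 * (h t)\<^sup>2" for n t
    using zero_le_power2[of "u n t - h t"] by (simp add: power2_sum power2_diff)
  have dom: "set_integrable lborel {0..L} (\<lambda>t. 2 * (u n t)\<^sup>2 + 2 * (h t)\<^sup>2)" for n
    by (intro set_integral_add(1) set_integrable_mult_right u2 h2)
  have uh2: "set_integrable lborel {0..L} (\<lambda>t. (u n t + h t)\<^sup>2)" for n
    by (rule integrable_on_dominated(1)[OF _ dom[of n]]) (use sq in auto)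
  have "integral {0..L} (\<lambda>t. (u n t + h t)\<^sup>2) \<le> integral {0..L} (\<lambda>t. 2 * (u n t)\<^sup>2 + 2 * (h t)\<^sup>2)" for n
    by (rule integral_le) (use sq set_borel_integral_eq_integral(1) uh2 dom in blast)+
  also have "\<dots> n = 2 * integral {0..L} (\<lambda>t. (u n t)\<^sup>2) + 2 * H" for n
    using set_borel_integral_eq_integral(1)[OF u2] set_borel_integral_eq_integral(1)[OF h2]
    by (simp add: integral_add integrable_on_mult_right H_def)
  also have "\<dots> n \<le> 2 * K + 2 * H" for n
    using K[of n] by (simp add: u_def)
  finally have uhK: "integral {0..L} (\<lambda>t. (u n t + h t)\<^sup>2) \<le> 2 * K + 2 * H" for n .
  have uhm: "(\<lambda>t. u n t + h t) \<in> borel_measurable borel" for n by measurable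
  define v where "v n x = integral {0..x} (\<lambda>t. (u n t + h t) * b t)" for n x
  obtain V0 and r :: "nat \<Rightarrow> nat" where V0: "continuous_on {0..L} V0" and r: "strict_mono r"
    and lim0: "\<And>x. x \<in> {0..L} \<Longrightarrow> (\<lambda>n. v (r n) x) \<longlonglongrightarrow> V0 x"
    unfolding v_def
    by (rule equibounded_derivative_subsequence[OF L uhm bm uh2 uhK bC]) (rule that[unfolded v_def])
  \<comment> \<open>Constant extension beyond the interval makes \<open>V\<close> continuous, hence
    Borel, on the whole line.\<close>
  define V where "V x = V0 (max 0 (min L x))" for x
  have Vc: "continuous_on UNIV V"
    unfolding V_def by (rule continuous_on_compose2[OF V0]) (use L in \<open>auto intro!: continuous_intros\<close>)
  have [measurable]: "V \<in> borel_measurable borel" by (rule borel_measurable_continuous_onI[OF Vc])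
  have lim: "(\<lambda>n. v (r n) x) \<longlonglongrightarrow> V x" if "x \<in> {0..L}" for x
    using lim0[OF that] that by (simp add: V_def)
  have r_top: "filterlim r at_top sequentially" by (rule filterlim_subseq[OF r])
  have zlim: "(\<lambda>n. z (r n) t) \<longlonglongrightarrow> V t" if "t \<in> {0..<L}" for t
  proof -
    have "(\<lambda>n. inverse (real (Suc (r n)))) \<longlonglongrightarrow> 0"
      by (rule filterlim_compose[OF LIMSEQ_inverse_real_of_nat r_top])
    then have "(\<lambda>n. z (r n) t - v (r n) t) \<longlonglongrightarrow> 0"
      by (rule Lim_null_comparison[rotated]) (use z[OF that] in \<open>auto simp: v_def u_def\<close>)
    from tendsto_add[OF this lim[of t]] that show ?thesis by simp
  qed
  define M where "M = restrict_space lborel {0..L}"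
  have M: "finite_measure M"
    by (rule finite_measureI) (simp add: M_def emeasure_restrict_space emeasure_lborel_Icc_eq)
  have Mm: "k \<in> borel_measurable borel \<Longrightarrow> k \<in> borel_measurable M" for k :: "real \<Rightarrow> 'b::topological_space"
    unfolding M_def by (rule measurable_restrict_space1) simp
  have \<phi>m[measurable]: "\<phi> \<in> borel_measurable borel"
    using \<phi>(1) by (intro borel_measurable_continuous_onI) (simp add: H_phi_def)
  have AElim: "AE t in M. (\<lambda>n. ereal (u (r n) t)) \<longlonglongrightarrow> \<phi> (V t)"
    unfolding M_def
  proof (subst AE_restrict_space_iff)
    show "AE t in lborel. t \<in> {0..L} \<longrightarrow> (\<lambda>n. ereal (u (r n) t)) \<longlonglongrightarrow> \<phi> (V t)"
      using AE_lborel_singleton[of L]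
      by eventually_elim (auto simp: u_def intro!: truncated_tendsto[OF \<phi>(1) zlim r_top])
  qed simp
  have u2K: "(\<integral>x. (u (r n) x)\<^sup>2 \<partial>M) \<le> K" for n
    using K[of "r n"] unfolding M_def lborel_restrict_conv set_borel_integral_eq_integral(2)[OF u2]
    by (simp add: u_def)
  have Um: "(\<lambda>t. \<phi> (V t)) \<in> borel_measurable M" by (rule Mm) measurable
  have u2M: "integrable M (\<lambda>x. (u (r n) x)\<^sup>2)" for n
    unfolding M_def lborel_restrict_conv by (rule u2)
  define f where "f t = real_of_ereal (\<phi> (V t))" for t
  have fm[measurable]: "f \<in> borel_measurable borel" unfolding f_def by measurable
  note lims = L2_bounded_pointwise_limit[OF M Mm[OF um] Um u2M u2K AElim, folded f_def]
  have f2: "set_integrable lborel {0..L} (\<lambda>t. (f t)\<^sup>2)"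
    using lims(2) unfolding M_def lborel_restrict_conv .
  have AE1: "AE x in lborel. x \<in> {0..L} \<longrightarrow> \<phi> (V x) \<noteq> \<infinity>"
    using lims(1) unfolding M_def by (subst (asm) AE_restrict_space_iff) (auto elim!: eventually_mono)
  note f1 = set_integrable_abs_of_square[OF fm f2] and h1 = set_integrable_abs_of_square[OF hm h2]
    and u1 = set_integrable_abs_of_square[OF um u2]
  have eq: "V x = integral {0..x} (\<lambda>t. (f t + h t) * b t)" if x: "x \<in> {0..L}" for x
  proof (rule LIMSEQ_unique[OF lim[OF x]])
    have sub: "k integrable_on {0..x}" if "k integrable_on {0..L}" for k :: "real \<Rightarrow> real"
      by (rule integrable_on_subinterval[OF that]) (use x in auto)
    have gio: "(\<lambda>t. (k t + h t) * b t) integrable_on {0..L}"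
      if [measurable]: "k \<in> borel_measurable borel" and k: "set_integrable lborel {0..L} (\<lambda>t. \<bar>k t\<bar>)" for k
      by (rule integrable_on_dominated(2)[of _ _ _ "\<lambda>t. (\<bar>k t\<bar> + \<bar>h t\<bar>) * C"])
        (use bC in \<open>auto simp: abs_mult intro!: mult_mono set_integrable_mult_left set_integral_add(1) k h1\<close>)
    have dio: "set_integrable lborel {0..L} (\<lambda>t. \<bar>u n t - f t\<bar>)" for n
      by (rule integrable_on_dominated(1)[of _ _ _ "\<lambda>t. \<bar>u n t\<bar> + \<bar>f t\<bar>"])
        (auto intro!: set_integral_add(1) u1 f1)
    \<comment> \<open>The \<open>h\<close> terms cancel and leave
      \<open>b t * (u (r n) t - f t)\<close>, so boundedness of \<open>b\<close> and convergence in
      L1 suffice.\<close>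
    have "(\<lambda>n. v (r n) x - integral {0..x} (\<lambda>t. (f t + h t) * b t)) \<longlonglongrightarrow> 0"
    proof (rule Lim_null_comparison)
      show "(\<lambda>n. C * (\<integral>t. \<bar>u (r n) t - f t\<bar> \<partial>M)) \<longlonglongrightarrow> 0"
        using tendsto_mult_right_zero[OF lims(3)] .
      show "\<forall>\<^sub>F n in sequentially. norm (v (r n) x - integral {0..x} (\<lambda>t. (f t + h t) * b t))
          \<le> C * (\<integral>t. \<bar>u (r n) t - f t\<bar> \<partial>M)"
      proof (rule always_eventually, rule allI)
        fix n
        note dn = set_borel_integral_eq_integral[OF dio[of "r n"]]
        have "v (r n) x - integral {0..x} (\<lambda>t. (f t + h t) * b t)
          = integral {0..x} (\<lambda>t. (u (r n) t + h t) * b t - (f t + h t) * b t)"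
          unfolding v_def
          by (rule Henstock_Kurzweil_Integration.integral_diff[symmetric]) (intro sub gio um u1 fm f1)+
        also have "norm \<dots> \<le> integral {0..x} (\<lambda>t. C * \<bar>u (r n) t - f t\<bar>)"
        proof (rule integral_norm_bound_integral)
          show "(\<lambda>t. (u (r n) t + h t) * b t - (f t + h t) * b t) integrable_on {0..x}"
            by (intro integrable_diff sub gio um u1 fm f1)
          show "(\<lambda>t. C * \<bar>u (r n) t - f t\<bar>) integrable_on {0..x}"
            by (intro integrable_on_mult_right sub dn(1))
          show "norm ((u (r n) t + h t) * b t - (f t + h t) * b t) \<le> C * \<bar>u (r n) t - f t\<bar>" for t
          proof -
            have "(u (r n) t + h t) * b t - (f t + h t) * b t = b t * (u (r n) t - f t)"
              by (simp add: algebra_simps)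
            then show ?thesis using mult_right_mono[OF bC[of t], of "\<bar>u (r n) t - f t\<bar>"]
              by (simp add: abs_mult)
          qed
        qed
        also have "\<dots> \<le> integral {0..L} (\<lambda>t. C * \<bar>u (r n) t - f t\<bar>)"
          using x bC[of 0] sub dn(1)
          by (intro integral_subset_le) (auto intro!: integrable_on_mult_right)
        also have "\<dots> = C * (\<integral>t. \<bar>u (r n) t - f t\<bar> \<partial>M)"
          unfolding M_def lborel_restrict_conv by (simp add: dn(2))
        finally show "norm (v (r n) x - integral {0..x} (\<lambda>t. (f t + h t) * b t))
          \<le> C * (\<integral>t. \<bar>u (r n) t - f t\<bar> \<partial>M)" .
      qed
    qed
    then show "(\<lambda>n. v (r n) x) \<longlonglongrightarrow> integral {0..x} (\<lambda>t. (f t + h t) * b t)"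
      by (simp add: LIM_zero_iff)
  qed
  have "V 0 = 0" using eq[of 0] L by simp
  show thesis
    by (rule that[OF Vc \<open>V 0 = 0\<close> AE1]) (use f2 eq in \<open>simp_all add: f_def\<close>)
qed

section \<open>From the integral equation to the weak formulation\<close>

theorem mainTheorem9:
  fixes L \<alpha> \<beta> :: real and a h :: "real \<Rightarrow> real" and \<phi> :: "real \<Rightarrow> ereal"
  assumes "L > 0"
    and "H_a L a \<alpha> \<beta>"
    and "L2_on L h"
    and "H_phi \<phi>" and "H_int \<phi>" and "H_bdd \<phi>"
  shows "\<exists>v. H1_on L v \<and> continuous_on {0..L} v \<and> v 0 = 0
    \<and> (AE x in lborel. x \<in> {0<..<L} \<longrightarrow> \<phi> (v x) \<noteq> \<infinity>)
    \<and> L2_on L (\<lambda>x. real_of_ereal (\<phi> (v x)))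
    \<and> (\<exists>w. L2_on L w \<and> weak_deriv_on L v w \<and>
         (\<forall>\<psi>. test_fun L \<psi> \<longrightarrow>
            (LINT x:{0<..<L}|lborel. a x * w x * \<psi> x)
          = (LINT x:{0<..<L}|lborel. (real_of_ereal (\<phi> (v x)) + h x) * \<psi> x)))"
proof -
  \<comment> \<open>The data are measurable only on the open interval; extension by 0 makes them
    Borel on the whole line, as the integral equation requires.\<close>
  define a0 where "a0 x = indicator {0<..<L} x * a x" for x
  define h0 where "h0 x = indicator {0<..<L} x * h x" for x
  \<comment> \<open>The value off the good set is immaterial but keeps the bounds on b valid everywhere.\<close>
  define b where "b x = (if x \<in> {0<..<L} \<and> \<alpha> \<le> a0 x \<and> a0 x \<le> \<beta> then inverse (a0 x) else inverse \<beta>)" for x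
  have pos: "0 < \<alpha>" "\<alpha> < \<beta>" and [measurable]: "a0 \<in> borel_measurable borel"
    and AEa: "AE x in lborel. x \<in> {0<..<L} \<longrightarrow> \<alpha> \<le> a x \<and> a x \<le> \<beta>"
    using assms(2) by (auto simp: H_a_def set_borel_measurable_def a0_def[abs_def])
  have [measurable]: "h0 \<in> borel_measurable borel"
    using assms(3) by (simp add: L2_on_def set_borel_measurable_def h0_def[abs_def])
  have [measurable]: "b \<in> borel_measurable borel" unfolding b_def by measurable
  have "integrable lborel (\<lambda>x. (h0 x)\<^sup>2)"
    using assms(3) by (simp add: L2_on_def set_integrable_def h0_def[abs_def] power_mult_distrib
        power2_eq_square[of "indicator _ _"] indicator_inter_arith[symmetric])
  then have h2: "set_integrable lborel {0..L} (\<lambda>x. (h0 x)\<^sup>2)"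
    unfolding set_integrable_def by (rule integrable_mult_indicator[rotated]) simp
  have c: "0 < inverse \<beta>" using pos by simp
  have b: "inverse \<beta> \<le> b x" "b x \<le> inverse \<alpha>" for x
    using pos by (auto simp: b_def le_imp_inverse_le)
  obtain V where Vc: "continuous_on UNIV V" and V0: "V 0 = 0"
    and AE1: "AE x in lborel. x \<in> {0..L} \<longrightarrow> \<phi> (V x) \<noteq> \<infinity>"
    and f2: "set_integrable lborel {0..L} (\<lambda>x. (real_of_ereal (\<phi> (V x)))\<^sup>2)"
    and V: "\<And>x. x \<in> {0..L} \<Longrightarrow> V x = integral {0..x} (\<lambda>t. (real_of_ereal (\<phi> (V t)) + h0 t) * b t)"
    using integral_equation_solvable[of L h0 b "inverse \<beta>" "inverse \<alpha>" \<phi>] assms(1,4-6) h2 c b by auto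
  have Vm[measurable]: "V \<in> borel_measurable borel" by (rule borel_measurable_continuous_onI[OF Vc])
  have \<phi>m[measurable]: "\<phi> \<in> borel_measurable borel"
    using assms(4) by (intro borel_measurable_continuous_onI) (simp add: H_phi_def)
  define f where "f t = real_of_ereal (\<phi> (V t))" for t
  define w where "w t = (f t + h0 t) * b t" for t
  have [measurable]: "f \<in> borel_measurable borel" unfolding f_def by measurable
  have wm[measurable]: "w \<in> borel_measurable borel" unfolding w_def by measurable
  have w2: "set_integrable lborel {0..L} (\<lambda>t. (w t)\<^sup>2)"
  proof (rule integrable_on_dominated(1))
    show "set_integrable lborel {0..L} (\<lambda>t. (2 * (f t)\<^sup>2 + 2 * (h0 t)\<^sup>2) * (inverse \<alpha>)\<^sup>2)"
      by (intro set_integrable_mult_left set_integral_add(1) set_integrable_mult_right h2)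
        (use f2 in \<open>simp add: f_def\<close>)
    show "\<bar>(w t)\<^sup>2\<bar> \<le> (2 * (f t)\<^sup>2 + 2 * (h0 t)\<^sup>2) * (inverse \<alpha>)\<^sup>2" for t
    proof -
      have "(f t + h0 t)\<^sup>2 \<le> 2 * (f t)\<^sup>2 + 2 * (h0 t)\<^sup>2"
        using zero_le_power2[of "f t - h0 t"] by (simp add: power2_sum power2_diff)
      moreover have "(b t)\<^sup>2 \<le> (inverse \<alpha>)\<^sup>2" using b(2)[of t] order_trans[OF less_imp_le[OF c] b(1)[of t]]
        by (intro power_mono)
      ultimately show ?thesis unfolding w_def power_mult_distrib abs_mult
        by (simp add: mult_mono)
    qed
  qed measurable
  have L2I: "L2_on L k" if km: "k \<in> borel_measurable borel" and k2: "set_integrable lborel {0..L} (\<lambda>t. (k t)\<^sup>2)" for k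
    unfolding L2_on_def set_borel_measurable_def
  proof
    show "(\<lambda>x. indicat_real {0<..<L} x *\<^sub>R k x) \<in> borel_measurable lborel" using km by measurable
    show "set_integrable lborel {0<..<L} (\<lambda>x. (k x)\<^sup>2)"
      by (rule set_integrable_subset[OF k2]) auto
  qed
  have wi: "set_integrable lborel {0..L} w"
    by (rule integrable_on_dominated(1)[OF wm set_integrable_abs_of_square[OF wm w2]]) simp
  have wd: "weak_deriv_on L V w"
  proof (rule weak_deriv_on_indefinite_integral)
    show "set_integrable lborel {0<..<L} w" by (rule set_integrable_subset[OF wi]) auto
    show "V x = (LINT t:{0<..<x}|lborel. w t)" if "x \<in> {0<..<L}" for x
    proof -
      have "set_integrable lborel {0<..<x} w"
        by (rule set_integrable_subset[OF wi]) (use that in auto)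
      from set_borel_integral_eq_integral(2)[OF this] show ?thesis
        using V[of x] that by (simp add: integral_open_interval_real w_def[abs_def] f_def)
    qed
  qed
  have Lw: "L2_on L w" by (rule L2I[OF wm w2])
  have "set_integrable lborel {0..L} (\<lambda>t. (V t)\<^sup>2)"
    by (intro borel_integrable_atLeastAtMost' continuous_intros continuous_on_subset[OF Vc]) auto
  then have H1: "H1_on L V" unfolding H1_on_def using L2I[OF Vm] Lw wd by blast
  have eq: "(LINT x:{0<..<L}|lborel. a x * w x * \<psi> x) = (LINT x:{0<..<L}|lborel. (f x + h x) * \<psi> x)"
    if "test_fun L \<psi>" for \<psi>
  proof -
    have "\<psi> differentiable (at x)" for x
      using that unfolding test_fun_def by (metis funpow_0)
    then have [measurable]: "\<psi> \<in> borel_measurable borel"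
      by (intro borel_measurable_continuous_onI continuous_at_imp_continuous_on ballI
          differentiable_imp_continuous_within) auto
    have "(LINT x:{0<..<L}|lborel. a x * w x * \<psi> x) = (\<integral>x. indicator {0<..<L} x * (a0 x * w x * \<psi> x) \<partial>lborel)"
      unfolding set_lebesgue_integral_def by (intro Bochner_Integration.integral_cong) (auto simp: a0_def indicator_def)
    also have "\<dots> = (\<integral>x. indicator {0<..<L} x * ((f x + h0 x) * \<psi> x) \<partial>lborel)"
    proof (rule integral_cong_AE)
      show "AE x in lborel. indicator {0<..<L} x * (a0 x * w x * \<psi> x) = indicator {0<..<L} x * ((f x + h0 x) * \<psi> x)"
        using AEa
      proof eventually_elim
        case (elim x)
        show ?case
        proof (cases "x \<in> {0<..<L}")
          case True
          \<comment> \<open>At almost every point of the interval the first branch of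
            \<open>b\<close> applies, so multiplication by the coefficient undoes the
            division.\<close>
          then have "a0 x * b x = 1" using elim pos by (simp add: b_def a0_def)
          then have "a0 x * w x = f x + h0 x" by (simp add: w_def mult.left_commute)
          then show ?thesis by simp
        qed simp
      qed
    qed measurable
    also have "\<dots> = (LINT x:{0<..<L}|lborel. (f x + h x) * \<psi> x)"
      unfolding set_lebesgue_integral_def by (intro Bochner_Integration.integral_cong) (auto simp: h0_def indicator_def)
    finally show ?thesis .
  qed
  have "AE x in lborel. x \<in> {0<..<L} \<longrightarrow> \<phi> (V x) \<noteq> \<infinity>"
    using AE1 by eventually_elim auto
  moreover have "L2_on L (\<lambda>x. real_of_ereal (\<phi> (V x)))"
    by (rule L2I[OF _ f2]) measurable
  ultimately show ?thesis
    using H1 continuous_on_subset[OF Vc] V0 Lw wd eq unfolding f_def by blast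
qed

end
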